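(* Let $\mathcal{G}$ be an additive arithmetical semigroup satisfying Axiom $A^{\#}$ (constants $c_{\mathcal{G}}>0$, $q>1$, $0\le\eta<1$) with $Z_{\mathcal{G}}(-q^{-1})\ne0$ and norm $\|g\|=q^{\partial(g)}$, and let $S\subseteq\mathcal{P}$ have natural density $\delta(S)$. Let $f\colon\mathbb{Z}_{\ge0}\to\mathbb{C}$ be bounded with $f(0)=0$, and let $a\colon\mathcal{G}\to\mathbb{C}$ be supported on $\mathfrak{D}(\mathcal{G},S)$ with $a(e_{\mathcal{G}})=1$ and $\lim_{n\to\infty}\sum_{1\le\partial(g)\le n,\ g\in\mathfrak{D}(\mathcal{G},S)}\frac{|a(g)|}{\|g\|}\log\log\|g\|<\infty$. Then the following three statements are equivalent: (i) $\sum_{\partial(g)=n}Q_S(g)f(d^+(g))=c_{\mathcal{G}}\delta(S)q^n+o(q^n)$ as $n\to\infty$; (ii) $-\lim_{n\to\infty}\sum_{1\le\partial(g)\le n,\ g\in\mathfrak{D}(\mathcal{G},S)}\frac{\mu(g)f(d_-(g))}{\|g\|}=\delta(S)$; (iii) $-\lim_{n\to\infty}\sum_{1\le\partial(g)\le n,\ g\in\mathfrak{D}(\mathcal{G},S)}\frac{(\mu*a)(g)f(d_-(g))}{\|g\|}=\delta(S)$.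
   Context: An additive arithmetical semigroup is a commutative monoid $\mathcal{G}$ (written additively, identity $e_{\mathcal{G}}$) freely generated by a countable set $\mathcal{P}$ of primes, with an additive degree map $\partial\colon\mathcal{G}\to\mathbb{Z}_{\ge0}$, $\partial(e_{\mathcal{G}})=0$, $\partial(P)>0$ for primes, finitely many elements of each degree. Axiom $A^{\#}$: $\#\{g:\partial(g)=n\}=c_{\mathcal{G}}q^n+O(q^{\eta n})$. $Z_{\mathcal{G}}(z)=\prod_{P\in\mathcal{P}}(1-z^{\partial(P)})^{-1}$ (meromorphically continued). Natural density: $\delta(S)=\lim_{n\to\infty}\#\{P\in S:\partial(P)=n\}/\#\{P\in\mathcal{P}:\partial(P)=n\}$. $h\mid g$ iff $g=h+r$, and $g-h:=r$. For $g\ne e_{\mathcal{G}}$, $d_-(g)$ and $d^+(g)$ are the minimal and maximal degrees of primes dividing $g$; $d^+(e_{\mathcal{G}})=0$. $g$ distinguishable: $g\ne e_{\mathcal{G}}$ and a unique prime $P_{\min}(g)\mid g$ has degree $d_-(g)$. $\mathfrak{D}(\mathcal{G},S)=\{g\text{ distinguishable}:P_{\min}(g)\in S\}\cup\{e_{\mathcal{G}}\}$. $Q_S(g)=\#\{P\in S:P\mid g,\ \partial(P)=d^+(g)\}$. $\mu$ is the Möbius function of $\mathcal{G}$; $(\mu*a)(g)=\sum_{h\mid g}\mu(h)a(g-h)$; $a$ supported on $\mathfrak{D}(\mathcal{G},S)$ means $a$ vanishes outside it. *)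

theory Defs
  imports "HOL-Analysis.Analysis" "HOL-Library.Multiset" "HOL-Library.Landau_Symbols"
begin

text \<open>An additive arithmetical semigroup is modelled concretely as the free commutative
monoid on the set of primes, i.e. finite multisets over a type 'p of primes, with
a degree function dg on primes extended additively. The identity is the empty multiset.\<close>

definition degG :: "('p \<Rightarrow> nat) \<Rightarrow> 'p multiset \<Rightarrow> nat" where
  "degG dg g = sum_mset (image_mset dg g)"

definition arith_semigroup :: "('p \<Rightarrow> nat) \<Rightarrow> bool" where
  "arith_semigroup dg \<longleftrightarrow> (\<forall>P. dg P > 0) \<and> (\<forall>n. finite {P. dg P = n})"

definition axiom_A_sharp :: "('p \<Rightarrow> nat) \<Rightarrow> real \<Rightarrow> real \<Rightarrow> real \<Rightarrow> bool" where
  "axiom_A_sharp dg c q \<eta> \<longleftrightarrow> c > 0 \<and> q > 1 \<and> 0 \<le> \<eta> \<and> \<eta> < 1 \<and>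
     (\<lambda>n. real (card {g::'p multiset. degG dg g = n}) - c * q ^ n) \<in> O(\<lambda>n. q powr (\<eta> * real n))"

text \<open>Euler product Z(z) = prod over primes of (1 - z^deg P)^(-1), grouped by degree.\<close>
definition zetaG :: "('p \<Rightarrow> nat) \<Rightarrow> complex \<Rightarrow> complex" where
  "zetaG dg z = (\<Prod>m. inverse ((1 - z ^ Suc m) ^ card {P. dg P = Suc m}))"

text \<open>Z(-1/q) \<noteq> 0 for the meromorphic continuation of Z (holomorphic on the disc of
radius q^(-eta) except for the simple pole at 1/q).\<close>
definition zeta_nonzero_at_minus :: "('p \<Rightarrow> nat) \<Rightarrow> real \<Rightarrow> real \<Rightarrow> bool" where
  "zeta_nonzero_at_minus dg q \<eta> \<longleftrightarrow>
     (\<exists>F. F holomorphic_on (ball (0::complex) (q powr (-\<eta>)) - {complex_of_real (1/q)}) \<and>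
          (\<forall>z\<in>ball 0 (1/q). F z = zetaG dg z) \<and>
          F (complex_of_real (-(1/q))) \<noteq> 0)"

definition d_minus :: "('p \<Rightarrow> nat) \<Rightarrow> 'p multiset \<Rightarrow> nat" where
  "d_minus dg g = Min (dg ` set_mset g)"

definition d_plus :: "('p \<Rightarrow> nat) \<Rightarrow> 'p multiset \<Rightarrow> nat" where
  "d_plus dg g = (if g = {#} then 0 else Max (dg ` set_mset g))"

definition distinguishable :: "('p \<Rightarrow> nat) \<Rightarrow> 'p multiset \<Rightarrow> bool" where
  "distinguishable dg g \<longleftrightarrow> g \<noteq> {#} \<and> (\<exists>!P. P \<in># g \<and> dg P = d_minus dg g)"

definition P_min :: "('p \<Rightarrow> nat) \<Rightarrow> 'p multiset \<Rightarrow> 'p" where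
  "P_min dg g = (THE P. P \<in># g \<and> dg P = d_minus dg g)"

definition Dset :: "('p \<Rightarrow> nat) \<Rightarrow> 'p set \<Rightarrow> 'p multiset set" where
  "Dset dg S = {g. distinguishable dg g \<and> P_min dg g \<in> S} \<union> {{#}}"

definition Q_S :: "('p \<Rightarrow> nat) \<Rightarrow> 'p set \<Rightarrow> 'p multiset \<Rightarrow> nat" where
  "Q_S dg S g = card {P \<in> S. P \<in># g \<and> dg P = d_plus dg g}"

definition mu_G :: "'p multiset \<Rightarrow> int" where
  "mu_G g = (if \<forall>P. count g P \<le> 1 then (-1) ^ size g else 0)"

definition conv_mu :: "('p multiset \<Rightarrow> complex) \<Rightarrow> 'p multiset \<Rightarrow> complex" where
  "conv_mu a g = (\<Sum>h\<in>{h. h \<subseteq># g}. of_int (mu_G h) * a (g - h))"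

definition natural_density :: "('p \<Rightarrow> nat) \<Rightarrow> 'p set \<Rightarrow> real \<Rightarrow> bool" where
  "natural_density dg S \<delta> \<longleftrightarrow>
     ((\<lambda>n. real (card {P \<in> S. dg P = n}) / real (card {P. dg P = n})) \<longlonglongrightarrow> \<delta>)"

end

theory Submission
  imports Defs "HOL-Complex_Analysis.Complex_Analysis"
begin

text \<open>
  Normalise all generating functions by \<open>q ^ deg\<close>, so that \<open>Z\<close> has its pole at \<open>1\<close>, and let \<open>M = 1 / Z\<close> be
  the generating function of the Moebius function. Sorting by the distinguished prime shows that the
  generating function \<open>A\<close> of the sums in (i) and the generating function \<open>B\<close> of the terms in (ii) satisfy
  \<open>A = - Z B\<close>. The function \<open>H(z) = (1 - z) Z(z)\<close> is holomorphic beyond the closed unit disc and has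
  no zero on it: \<open>H(1) = c\<close>, \<open>H(-1)\<close> is nonzero by assumption, and the remaining points of the circle are
  handled by the 3-4-1 inequality. Hence the coefficients of both \<open>H\<close> and \<open>1 / H\<close> are absolutely summable.
  As \<open>A = - H (B / (1 - z))\<close> and \<open>B / (1 - z) = - (1 / H) A\<close>, where the coefficients of \<open>B / (1 - z)\<close> are
  the partial sums in (ii), the limits in (i) and (ii) determine each other.

  The difference of the partial sums in (iii) and (ii) is a sum over \<open>h \<noteq> e\<close> of \<open>a(h) / q ^ deg h\<close> times a
  partial sum over the \<open>r\<close> with \<open>h + r\<close> distinguishable. The latter is a combination of partial sums of
  Moebius sums over elements without prime divisors of small degree; these are uniformly bounded and
  tend to \<open>0\<close>, since they arise by convolving the summable coefficients of \<open>1 / H\<close> with a bounded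
  null sequence. A Mertens-type bound on the number of terms makes \<open>log log\<close> a dominating weight, and
  dominated convergence shows that the difference tends to \<open>0\<close>.
\<close>

subsection \<open>Generating functions of a graded free commutative monoid\<close>

lemma degG_empty [simp]: "degG dg {#} = 0"
  and degG_add [simp]: "degG dg (g + h) = degG dg g + degG dg h"
  and degG_single [simp]: "degG dg {#P#} = dg P"
  and degG_add_mset [simp]: "degG dg (add_mset P g) = dg P + degG dg g"
  by (simp_all add: degG_def)

definition free_on :: "'p set \<Rightarrow> 'p multiset set" where
  "free_on A = {g. set_mset g \<subseteq> A}"

lemma mu_G_empty [simp]: "mu_G {#} = 1"
  and mu_G_single [simp]: "mu_G {#P#} = -1"
  by (simp_all add: mu_G_def)

lemma mu_G_add_disjoint:
  assumes "set_mset g \<inter> set_mset h = {}"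
  shows "mu_G (g + h) = mu_G g * mu_G h"
proof -
  have "count (g + h) P \<le> 1 \<longleftrightarrow> count g P \<le> 1 \<and> count h P \<le> 1" for P
  proof -
    have "count g P = 0 \<or> count h P = 0"
      using assms by (auto simp: count_eq_zero_iff)
    then show ?thesis by auto
  qed
  then show ?thesis
    by (auto simp: mu_G_def power_add)
qed

lemma mu_G_nonzeroD: "mu_G g \<noteq> 0 \<Longrightarrow> count g P \<le> 1"
  by (auto simp: mu_G_def split: if_splits)

lemma norm_mu_G_le: "norm (of_int (mu_G g) :: complex) \<le> 1"
  by (auto simp: mu_G_def norm_power)

locale graded_primes =
  fixes dg :: "'p \<Rightarrow> nat" and q :: real
  assumes dg_pos: "dg P > 0" and finite_dg: "finite {P. dg P = n}" and q_gt_1: "q > 1"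
begin

abbreviation deg :: "'p multiset \<Rightarrow> nat" where "deg \<equiv> degG dg"

lemma q_pos: "q > 0" and q_nonzero [simp]: "q \<noteq> 0"
  using q_gt_1 by auto

lemma finite_dg_le: "finite {P. dg P \<le> n}"
proof -
  have "{P. dg P \<le> n} = (\<Union>m\<le>n. {P. dg P = m})" by auto
  then show ?thesis using finite_dg by simp
qed

lemma dg_le_deg: "P \<in># g \<Longrightarrow> dg P \<le> deg g"
  by (metis degG_add_mset insert_DiffM le_add1)

lemma size_le_deg: "size g \<le> deg g"
proof (induction g)
  case (add P g)
  then show ?case using dg_pos[of P] by simp
qed simp

lemma deg_eq_0_iff [simp]: "deg g = 0 \<longleftrightarrow> g = {#}"
  using size_le_deg[of g] by auto

lemma finite_deg_le: "finite {g. deg g \<le> n}"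
proof (rule finite_subset)
  show "{g. deg g \<le> n} \<subseteq> (\<Union>m\<le>n. multisets_of_size {P. dg P \<le> n} m)"
  proof
    fix g assume "g \<in> {g. deg g \<le> n}"
    then have "size g \<le> n" "\<forall>P\<in>set_mset g. dg P \<le> n"
      using size_le_deg[of g] dg_le_deg[of _ g] by force+
    then show "g \<in> (\<Union>m\<le>n. multisets_of_size {P. dg P \<le> n} m)"
      by (auto simp: multisets_of_size_def)
  qed
  show "finite (\<Union>m\<le>n. multisets_of_size {P. dg P \<le> n} m)"
    by (auto intro!: finite_multisets_of_size finite_dg_le)
qed

lemma finite_deg_eq [simp]: "finite {g. deg g = n}"
  by (rule finite_subset[OF _ finite_deg_le[of n]]) auto

lemma finite_deg_eq_on [simp]: "finite {g \<in> X. deg g = n}"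
  by (rule finite_subset[OF _ finite_deg_le[of n]]) auto

text \<open>At z this is the sum of w(g) (z / q)^deg g over \<open>X\<close>; the scaling moves the
  pole of Z from 1 / q to 1.\<close>

definition gf :: "('p multiset \<Rightarrow> complex) \<Rightarrow> 'p multiset set \<Rightarrow> complex fps" where
  "gf w X = Abs_fps (\<lambda>n. (\<Sum>g\<in>{g \<in> X. deg g = n}. w g) / of_real q ^ n)"

lemma gf_nth: "fps_nth (gf w X) n = (\<Sum>g\<in>{g \<in> X. deg g = n}. w g) / of_real q ^ n"
  by (simp add: gf_def)

text \<open>\<open>X\<close> and \<open>Y\<close> may differ by elements of weight 0. This is how
  elements with a repeated prime, where the Moebius function vanishes, are dropped later.\<close>

lemma gf_nth_cong:
  assumes "\<And>g. deg g = n \<Longrightarrow> g \<in> X \<Longrightarrow> g \<in> Y \<or> w g = 0"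
    and "\<And>g. deg g = n \<Longrightarrow> g \<in> Y \<Longrightarrow> g \<in> X \<or> v g = 0"
    and "\<And>g. deg g = n \<Longrightarrow> g \<in> X \<Longrightarrow> g \<in> Y \<Longrightarrow> w g = v g"
  shows "fps_nth (gf w X) n = fps_nth (gf v Y) n"
proof -
  have "(\<Sum>g\<in>{g \<in> X. deg g = n}. w g) = (\<Sum>g\<in>{g \<in> Y. deg g = n}. v g)"
    by (rule sum.mono_neutral_cong) (use assms in auto)
  then show ?thesis by (simp add: gf_nth)
qed

lemma gf_cong:
  assumes "\<And>g. g \<in> X \<Longrightarrow> g \<in> Y \<or> w g = 0"
    and "\<And>g. g \<in> Y \<Longrightarrow> g \<in> X \<or> v g = 0"
    and "\<And>g. g \<in> X \<Longrightarrow> g \<in> Y \<Longrightarrow> w g = v g"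
  shows "gf w X = gf v Y"
  by (rule fps_ext, rule gf_nth_cong) (use assms in blast)+

lemma gf_Un:
  assumes "X \<inter> Y = {}"
  shows "gf w (X \<union> Y) = gf w X + gf w Y"
proof (rule fps_ext)
  fix n
  have "{g \<in> X \<union> Y. deg g = n} = {g \<in> X. deg g = n} \<union> {g \<in> Y. deg g = n}" by auto
  then have "(\<Sum>g\<in>{g \<in> X \<union> Y. deg g = n}. w g)
      = (\<Sum>g\<in>{g \<in> X. deg g = n}. w g) + (\<Sum>g\<in>{g \<in> Y. deg g = n}. w g)"
    using assms by (simp only:) (subst sum.union_disjoint, auto)
  then show "fps_nth (gf w (X \<union> Y)) n = fps_nth (gf w X + gf w Y) n"
    by (simp add: gf_nth add_divide_distrib)
qed

lemma gf_UN:
  assumes "finite I" and "disjoint_family_on X I"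
  shows "gf w (\<Union>i\<in>I. X i) = (\<Sum>i\<in>I. gf w (X i))"
  using assms
proof (induction I rule: finite_induct)
  case empty
  then show ?case by (simp add: gf_def fps_eq_iff)
next
  case (insert i I)
  then have "X i \<inter> (\<Union>i\<in>I. X i) = {}" "disjoint_family_on X I"
    by (auto simp: disjoint_family_on_def)
  then show ?case using insert by (simp add: gf_Un)
qed

lemma gf_singleton: "gf w {g} = fps_const (w g / of_real q ^ deg g) * fps_X ^ deg g"
proof (rule fps_ext)
  fix n
  have "{h \<in> {g}. deg h = n} = (if deg g = n then {g} else {})" by auto
  then show "fps_nth (gf w {g}) n = fps_nth (fps_const (w g / of_real q ^ deg g) * fps_X ^ deg g) n"
    by (auto simp: gf_nth fps_X_power_nth)
qed

lemma gf_cmult: "gf (\<lambda>g. c * w g) X = fps_const c * gf w X"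
  by (simp add: fps_eq_iff gf_nth sum_distrib_left)

text \<open>The bijection expresses unique decomposition g = h + r. Degrees add, so the normalising
  factors satisfy q^n = q^i q^(n - i) and the Cauchy product collects the pairs of total degree
  n.\<close>

lemma gf_mult:
  assumes bij: "bij_betw (\<lambda>(h, r). h + r) (X \<times> Y) Z"
    and w: "\<And>h r. h \<in> X \<Longrightarrow> r \<in> Y \<Longrightarrow> w (h + r) = u h * v r"
  shows "gf u X * gf v Y = gf w Z"
proof (rule fps_ext)
  fix n
  let ?T = "SIGMA i:{0..n}. {h \<in> X. deg h = i} \<times> {r \<in> Y. deg r = n - i}"
  have inj: "inj_on (\<lambda>(h, r). h + r) (X \<times> Y)" and im: "(\<lambda>(h, r). h + r) ` (X \<times> Y) = Z"
    using bij by (auto simp: bij_betw_def)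
  have "fps_nth (gf u X * gf v Y) n =
      (\<Sum>i=0..n. (\<Sum>h\<in>{h \<in> X. deg h = i}. \<Sum>r\<in>{r \<in> Y. deg r = n - i}. u h * v r) / of_real q ^ n)"
    unfolding fps_mult_nth
  proof (rule sum.cong)
    fix i assume "i \<in> {0..n}"
    then have "complex_of_real q ^ n = of_real q ^ i * of_real q ^ (n - i)"
      by (simp flip: power_add)
    then show "fps_nth (gf u X) i * fps_nth (gf v Y) (n - i) =
      (\<Sum>h\<in>{h \<in> X. deg h = i}. \<Sum>r\<in>{r \<in> Y. deg r = n - i}. u h * v r) / of_real q ^ n"
      by (simp add: gf_nth sum_product)
  qed simp
  also have "\<dots> = (\<Sum>(i, h, r)\<in>?T. u h * v r) / of_real q ^ n"
    by (simp add: sum.Sigma sum.cartesian_product flip: sum_divide_distrib)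
  also have "(\<Sum>(i, h, r)\<in>?T. u h * v r) = (\<Sum>g\<in>{g \<in> Z. deg g = n}. w g)"
  proof (rule sum.reindex_bij_betw_not_neutral[where S' = "{}" and T' = "{}" and h = "\<lambda>(i, h, r). h + r",
        THEN trans[rotated]])
    show "bij_betw (\<lambda>(i, h, r). h + r) (?T - {}) ({g \<in> Z. deg g = n} - {})"
      unfolding bij_betw_def
    proof
      show "inj_on (\<lambda>(i, h, r). h + r) (?T - {})"
      proof (rule inj_onI)
        fix x y assume xy: "x \<in> ?T - {}" "y \<in> ?T - {}"
          and eq: "(case x of (i, h, r) \<Rightarrow> h + r) = (case y of (i, h, r) \<Rightarrow> h + r)"
        obtain i h r where x: "x = (i, h, r)" by (cases x)
        obtain i' h' r' where y: "y = (i', h', r')" by (cases y)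
        have "(h, r) = (h', r')"
          by (rule inj_onD[OF inj]) (use xy eq x y in auto)
        then show "x = y" using xy x y by auto
      qed
      show "(\<lambda>(i, h, r). h + r) ` (?T - {}) = {g \<in> Z. deg g = n} - {}"
      proof (intro equalityI subsetI)
        fix g assume "g \<in> {g \<in> Z. deg g = n} - {}"
        then obtain h r where hr: "h \<in> X" "r \<in> Y" "g = h + r" "deg h + deg r = n"
          by (auto simp flip: im)
        then have "(deg h, h, r) \<in> ?T - {}" by auto
        then show "g \<in> (\<lambda>(i, h, r). h + r) ` (?T - {})"
          using hr(3) by force
      qed (auto simp flip: im)
    qed
    show "(\<Sum>(i, h, r)\<in>?T. u h * v r) = (\<Sum>x\<in>?T. w (case x of (i, h, r) \<Rightarrow> h + r))"
      by (rule sum.cong) (auto simp: w)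
  qed auto
  finally show "fps_nth (gf u X * gf v Y) n = fps_nth (gf w Z) n"
    by (simp add: gf_nth)
qed

section \<open>Zeta and Moebius series of an arbitrary set of primes\<close>

definition Nfps :: "'p set \<Rightarrow> complex fps" where "Nfps A = gf (\<lambda>_. 1) (free_on A)"

definition Mfps :: "'p set \<Rightarrow> complex fps" where "Mfps A = gf (\<lambda>g. of_int (mu_G g)) (free_on A)"

definition prime_fps :: "'p \<Rightarrow> complex fps" where
  "prime_fps P = fps_const (1 / of_real q ^ dg P) * fps_X ^ dg P"

lemma bij_betw_free_on_Un:
  assumes "A \<inter> B = {}"
  shows "bij_betw (\<lambda>(h, r). h + r) (free_on A \<times> free_on B) (free_on (A \<union> B))"
proof (rule bij_betwI[where g = "\<lambda>g. (filter_mset (\<lambda>P. P \<in> A) g, filter_mset (\<lambda>P. P \<notin> A) g)"])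
  show "(\<lambda>(h, r). h + r) \<in> free_on A \<times> free_on B \<rightarrow> free_on (A \<union> B)"
    by (auto simp: free_on_def)
  show "(\<lambda>g. (filter_mset (\<lambda>P. P \<in> A) g, filter_mset (\<lambda>P. P \<notin> A) g)) \<in> free_on (A \<union> B) \<rightarrow> free_on A \<times> free_on B"
    by (auto simp: free_on_def)
next
  fix x assume "x \<in> free_on A \<times> free_on B"
  then obtain h r where x: "x = (h, r)" "set_mset h \<subseteq> A" "set_mset r \<subseteq> B"
    by (auto simp: free_on_def)
  then have "filter_mset (\<lambda>P. P \<in> A) h = h" "filter_mset (\<lambda>P. P \<in> A) r = {#}"
    "filter_mset (\<lambda>P. P \<notin> A) h = {#}" "filter_mset (\<lambda>P. P \<notin> A) r = r"
    using assms by (auto simp: filter_mset_eq_conv filter_mset_eq_mempty_iff)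
  then show "(filter_mset (\<lambda>P. P \<in> A) (case x of (h, r) \<Rightarrow> h + r),
      filter_mset (\<lambda>P. P \<notin> A) (case x of (h, r) \<Rightarrow> h + r)) = x"
    by (simp add: x)
qed auto

lemma Nfps_Un: "A \<inter> B = {} \<Longrightarrow> Nfps (A \<union> B) = Nfps A * Nfps B"
  unfolding Nfps_def by (rule sym, rule gf_mult[OF bij_betw_free_on_Un]) auto

lemma Mfps_Un: "A \<inter> B = {} \<Longrightarrow> Mfps (A \<union> B) = Mfps A * Mfps B"
  unfolding Mfps_def
  by (rule sym, rule gf_mult[OF bij_betw_free_on_Un], assumption)
    (subst mu_G_add_disjoint, auto simp: free_on_def)

lemma free_on_empty [simp]: "free_on {} = {{#}}"
  by (auto simp: free_on_def)

lemma Nfps_empty [simp]: "Nfps {} = 1" and Mfps_empty [simp]: "Mfps {} = 1"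
  by (simp_all add: Nfps_def Mfps_def gf_singleton)

lemma bij_betw_add_prime:
  "bij_betw (\<lambda>(h, r). h + r) ({{#P#}} \<times> Y) (add_mset P ` Y)"
  by (auto simp: bij_betw_def inj_on_def image_iff)

lemma gf_add_prime:
  assumes "\<And>r. r \<in> Y \<Longrightarrow> w (add_mset P r) = c * v r"
  shows "gf w (add_mset P ` Y) = fps_const c * prime_fps P * gf v Y"
proof -
  have "gf (\<lambda>_. c) {{#P#}} * gf v Y = gf w (add_mset P ` Y)"
    by (rule gf_mult[OF bij_betw_add_prime]) (auto simp: assms)
  moreover have "gf (\<lambda>_. c) {{#P#}} = fps_const c * prime_fps P"
    by (simp add: gf_singleton prime_fps_def flip: mult.assoc)
  ultimately show ?thesis by simp
qed

text \<open>An element over one prime is the identity or P plus another such element, so the series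
  is geometric.\<close>

lemma Nfps_singleton: "Nfps {P} * (1 - prime_fps P) = 1"
proof -
  have "free_on {P} = {{#}} \<union> add_mset P ` free_on {P}"
  proof (intro equalityI subsetI)
    fix g assume g: "g \<in> free_on {P}"
    show "g \<in> {{#}} \<union> add_mset P ` free_on {P}"
      using g by (cases g) (auto simp: free_on_def)
  qed (auto simp: free_on_def)
  then have "Nfps {P} = gf (\<lambda>_. 1) ({{#}} \<union> add_mset P ` free_on {P})"
    by (simp add: Nfps_def)
  also have "\<dots> = 1 + prime_fps P * Nfps {P}"
    by (subst gf_Un, force) (simp add: gf_singleton Nfps_def gf_add_prime[where c = 1 and v = "\<lambda>_. 1"])
  finally show ?thesis by (simp add: algebra_simps)
qed

lemma Mfps_singleton: "Mfps {P} = 1 - prime_fps P"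
proof -
  have "Mfps {P} = gf (\<lambda>g. of_int (mu_G g)) ({{#}} \<union> add_mset P ` {{#}})"
    unfolding Mfps_def
  proof (rule gf_cong)
    fix g assume g: "g \<in> free_on {P}"
    show "g \<in> {{#}} \<union> add_mset P ` {{#}} \<or> complex_of_int (mu_G g) = 0"
    proof (rule disjCI)
      assume "complex_of_int (mu_G g) \<noteq> 0"
      then have "count g P \<le> 1" by (auto dest: mu_G_nonzeroD)
      then show "g \<in> {{#}} \<union> add_mset P ` {{#}}"
        using g by (cases g) (auto simp: free_on_def count_eq_zero_iff subset_singleton_iff)
    qed
  qed (auto simp: free_on_def)
  also have "\<dots> = 1 - prime_fps P"
    by (subst gf_Un, force) (simp add: gf_singleton prime_fps_def)
  finally show ?thesis .
qed

lemma Mfps_finite: "finite A \<Longrightarrow> Mfps A = (\<Prod>P\<in>A. 1 - prime_fps P)"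
proof (induction A rule: finite_induct)
  case (insert P A)
  then show ?case using Mfps_Un[of "{P}" A] by (simp add: Mfps_singleton)
qed simp

lemma Nfps_Mfps_finite: "finite A \<Longrightarrow> Nfps A * Mfps A = 1"
proof (induction A rule: finite_induct)
  case (insert P A)
  have "Nfps (insert P A) * Mfps (insert P A) = (Nfps {P} * Mfps {P}) * (Nfps A * Mfps A)"
    using insert.hyps Nfps_Un[of "{P}" A] Mfps_Un[of "{P}" A] by (simp add: algebra_simps)
  then show ?case using insert by (simp add: Mfps_singleton Nfps_singleton)
qed simp

text \<open>A prime dividing an element of degree n has degree at most n, so each coefficient sees
  only finitely many primes.\<close>

lemma gf_free_on_truncate:
  assumes "n \<le> m"
  shows "fps_nth (gf w (free_on (A \<inter> {P. dg P \<le> m}))) n = fps_nth (gf w (free_on A)) n"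
proof (rule gf_nth_cong)
  fix g assume "deg g = n" "g \<in> free_on A"
  moreover from this have "dg P \<le> m" if "P \<in># g" for P
    using dg_le_deg[OF that] assms by simp
  ultimately show "g \<in> free_on (A \<inter> {P. dg P \<le> m}) \<or> w g = 0"
    by (auto simp: free_on_def)
qed (auto simp: free_on_def)

text \<open>The coefficient of index n depends only on the primes of degree at most n; for this
  finite set the identity is a product of local ones.\<close>

lemma Nfps_Mfps: "Nfps A * Mfps A = 1"
proof (rule fps_ext)
  fix n
  let ?A = "A \<inter> {P. dg P \<le> n}"
  have "fps_nth (Nfps A * Mfps A) n = fps_nth (Nfps ?A * Mfps ?A) n"
    unfolding fps_mult_nth Nfps_def Mfps_def
    by (intro sum.cong refl) (simp add: gf_free_on_truncate)
  also have "Nfps ?A * Mfps ?A = 1"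
    by (rule Nfps_Mfps_finite) (simp add: finite_dg_le)
  finally show "fps_nth (Nfps A * Mfps A) n = fps_nth 1 n" .
qed

end

subsection \<open>Convolutions and power series\<close>

text \<open>Tannery's theorem applied to the convolution, with majorant the norms of the
  coefficients of \<open>F\<close> times a bound for those of \<open>G\<close>. This transports
  limits between (i) and (ii).\<close>

lemma fps_mult_nth_tendsto:
  fixes F G :: "complex fps"
  assumes F: "summable (\<lambda>n. norm (fps_nth F n))" and G: "fps_nth G \<longlonglongrightarrow> L"
  shows "fps_nth (F * G) \<longlonglongrightarrow> suminf (fps_nth F) * L"
proof -
  \<comment> \<open>Extending by 0 for k > n makes the n-th coefficient an infinite series in k, as
    Tannery's theorem requires.\<close>
  define a where "a = (\<lambda>k n. if k \<le> n then fps_nth F k * fps_nth G (n - k) else 0)"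
  from G have "Bseq (fps_nth G)" by (meson convergentI convergent_imp_Bseq)
  then obtain B where B: "\<And>n. norm (fps_nth G n) \<le> B" and "B > 0" by (metis BseqE)
  have "((\<lambda>n. suminf (\<lambda>k. a k n)) \<longlonglongrightarrow> suminf (\<lambda>k. fps_nth F k * L))"
  proof (rule conjunct2[OF conjunct2[OF tannerys_theorem[where M = "\<lambda>k. norm (fps_nth F k) * B"]]])
    fix k
    have "(\<lambda>n. fps_nth G (n - k)) \<longlonglongrightarrow> L"
      using G by (simp add: LIMSEQ_offset[where k = k])
    then have "(\<lambda>n. fps_nth F k * fps_nth G (n - k)) \<longlonglongrightarrow> fps_nth F k * L"
      by (intro tendsto_intros)
    moreover have "eventually (\<lambda>n. fps_nth F k * fps_nth G (n - k) = a k n) sequentially"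
      using eventually_ge_at_top[of k] by eventually_elim (simp add: a_def)
    ultimately show "(\<lambda>n. a k n) \<longlonglongrightarrow> fps_nth F k * L"
      by (rule Lim_transform_eventually)
    show "\<forall>\<^sub>F (k, n) in sequentially \<times>\<^sub>F sequentially. norm (a k n) \<le> norm (fps_nth F k) * B"
      using B \<open>B > 0\<close> by (intro always_eventually) (auto simp: a_def norm_mult mult_left_mono)
  qed (use F in \<open>auto intro: summable_mult2\<close>)
  moreover have "suminf (\<lambda>k. a k n) = fps_nth (F * G) n" for n
    by (subst suminf_finite[of "{0..n}"]) (auto simp: a_def fps_mult_nth)
  moreover have "suminf (\<lambda>k. fps_nth F k * L) = suminf (fps_nth F) * L"
    using summable_norm_cancel[OF F] by (rule suminf_mult2[symmetric])
  ultimately show ?thesis by simp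
qed

text \<open>Young's inequality for a summable and a bounded sequence; the bound is uniform in
  n.\<close>

lemma norm_fps_mult_nth_le:
  fixes F G :: "complex fps"
  assumes F: "summable (\<lambda>n. norm (fps_nth F n))" and G: "\<And>n. norm (fps_nth G n) \<le> B"
  shows "norm (fps_nth (F * G) n) \<le> (\<Sum>n. norm (fps_nth F n)) * B"
proof -
  have "B \<ge> 0" using G[of 0] norm_ge_zero order_trans by blast
  have "norm (fps_nth (F * G) n) \<le> (\<Sum>i=0..n. norm (fps_nth F i) * B)"
    unfolding fps_mult_nth
    by (intro order.trans[OF norm_sum] sum_mono) (simp add: norm_mult G mult_left_mono)
  also have "\<dots> = (\<Sum>i=0..n. norm (fps_nth F i)) * B" by (simp add: sum_distrib_right)
  also have "\<dots> \<le> (\<Sum>n. norm (fps_nth F n)) * B"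
    using F \<open>B \<ge> 0\<close> by (intro mult_right_mono sum_le_suminf) auto
  finally show ?thesis .
qed

text \<open>The series of 1 / (1 - z); multiplying by it forms partial sums.\<close>

definition ones_fps :: "complex fps" where "ones_fps = Abs_fps (\<lambda>_. 1)"

lemma mult_ones_fps_nth: "fps_nth (F * ones_fps) n = (\<Sum>i\<le>n. fps_nth F i)"
  by (simp add: ones_fps_def fps_mult_nth atLeast0AtMost)

lemma one_minus_X_mult_nth:
  "fps_nth (F * (1 - fps_X)) n = fps_nth F n - (if n = 0 then 0 else fps_nth F (n - 1))"
  for F :: "complex fps"
  by (simp add: right_diff_distrib fps_mult_fps_X_commute[symmetric])

lemma ones_fps_inverse: "ones_fps * (1 - fps_X) = 1"
  by (rule fps_ext) (simp only: one_minus_X_mult_nth, simp add: ones_fps_def)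

lemma fps_conv_radius_geometric_bound:
  fixes F :: "complex fps"
  assumes F: "\<And>n. norm (fps_nth F n) \<le> C * \<rho> ^ n" and \<rho>: "\<rho> > 0"
  shows "fps_conv_radius F \<ge> 1 / \<rho>"
  unfolding fps_conv_radius_def
proof (rule conv_radius_geI_ex')
  fix r :: real assume r: "0 < r" "ereal r < ereal (1 / \<rho>)"
  then have r': "\<rho> * r < 1" using \<rho> by (simp add: field_simps)
  show "summable (\<lambda>n. fps_nth F n * of_real r ^ n)"
  proof (rule summable_comparison_test')
    show "summable (\<lambda>n. C * (\<rho> * r) ^ n)"
      using r r' \<rho> by (intro summable_mult summable_geometric) simp
    fix n
    have "norm (fps_nth F n * of_real r ^ n) = norm (fps_nth F n) * r ^ n"
      using r by (simp add: norm_mult norm_power)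
    also have "\<dots> \<le> C * \<rho> ^ n * r ^ n" using F r by (intro mult_right_mono) auto
    finally show "norm (fps_nth F n * of_real r ^ n) \<le> C * (\<rho> * r) ^ n"
      by (simp add: power_mult_distrib)
  qed
qed

lemma eval_fps_prod:
  fixes F :: "'i \<Rightarrow> complex fps"
  assumes "\<And>i. i \<in> I \<Longrightarrow> fps_conv_radius (F i) = \<infinity>"
  shows "fps_conv_radius (\<Prod>i\<in>I. F i) = \<infinity> \<and> eval_fps (\<Prod>i\<in>I. F i) z = (\<Prod>i\<in>I. eval_fps (F i) z)"
  using assms
proof (induction I rule: infinite_finite_induct)
  case (insert i I)
  then show ?case
    using fps_conv_radius_mult[of "F i" "\<Prod>i\<in>I. F i"] by (simp add: eval_fps_mult)
qed auto

text \<open>Take logarithms: ln |1 - w| is minus the sum of Re(w^n) / n, and the n-th terms combine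
  to -2 r^n (1 + cos t)^2 / n with t the argument of u^n, since 3 + 4 cos t + cos 2t = 2 (1 + cos
  t)^2.\<close>

lemma three_four_one:
  fixes u :: complex and r :: real
  assumes r: "0 \<le> r" "r < 1" and u: "norm u = 1"
  shows "norm (1 - of_real r :: complex) ^ 3 * norm (1 - of_real r * u) ^ 4 * norm (1 - of_real r * u ^ 2) \<le> 1"
proof -
  have sums: "(\<lambda>n. - Re (w ^ n) / real n) sums ln (norm (1 - w))" if w: "norm w < 1" for w :: complex
  proof -
    have "(\<lambda>n. - (w ^ n) / of_nat n) sums ln (1 - w)"
      using Ln_series'[of "-w"] w by simp
    then have "(\<lambda>n. Re (- (w ^ n) / of_nat n)) sums Re (ln (1 - w))"
      by (rule sums_Re)
    moreover have "w \<noteq> 1" using w by auto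
    ultimately show ?thesis by (simp add: Re_divide_of_nat)
  qed
  let ?a = "norm (1 - of_real r :: complex)" and ?b = "norm (1 - of_real r * u)"
    and ?c = "norm (1 - of_real r * u ^ 2)"
  have pos: "?a > 0" "?b > 0" "?c > 0"
  proof -
    have "w \<noteq> 1" if "norm w < 1" for w :: complex using that by auto
    moreover have "norm (complex_of_real r) < 1" "norm (of_real r * u) < 1" "norm (of_real r * u ^ 2) < 1"
      using r u by (auto simp: norm_mult norm_power)
    ultimately show "?a > 0" "?b > 0" "?c > 0"
      by (metis right_minus_eq zero_less_norm_iff)+
  qed
  have "(\<lambda>n. 3 * (- Re (of_real r ^ n) / real n) + 4 * (- Re ((of_real r * u) ^ n) / real n)
      + (- Re ((of_real r * u ^ 2) ^ n) / real n)) sums (3 * ln ?a + 4 * ln ?b + ln ?c)"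
    using r u by (intro sums_add sums_mult sums) (auto simp: norm_mult norm_power)
  moreover have "3 * (- Re (of_real r ^ n) / real n) + 4 * (- Re ((of_real r * u) ^ n) / real n)
      + (- Re ((of_real r * u ^ 2) ^ n) / real n) \<le> 0" for n
  proof -
    define v where "v = u ^ n"
    have "norm v = 1" using u by (simp add: v_def norm_power)
    then have "(Re v)\<^sup>2 + (Im v)\<^sup>2 = 1" by (simp add: cmod_def)
    then have re2: "Re (v ^ 2) = 2 * (Re v)\<^sup>2 - 1" by (simp add: power2_eq_square)
    have v2: "(u ^ 2) ^ n = v ^ 2" by (simp add: v_def mult.commute flip: power_mult)
    have "3 * (- Re (of_real r ^ n) / real n) + 4 * (- Re ((of_real r * u) ^ n) / real n)
      + (- Re ((of_real r * u ^ 2) ^ n) / real n) = - (2 * (r ^ n * (1 + Re v)\<^sup>2 / real n))"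
      unfolding power_mult_distrib v2 v_def[symmetric]
      \<comment> \<open>The term of index 0 is 0 by the convention on division by zero.\<close>
      by (simp add: re2 flip: of_real_power) (cases "n = 0"; simp add: field_simps power2_eq_square)
    also have "\<dots> \<le> 0" using r by simp
    finally show ?thesis .
  qed
  ultimately have "3 * ln ?a + 4 * ln ?b + ln ?c \<le> 0"
    by (rule sums_le[OF _ _ sums_zero, rotated])
  then have "ln (?a ^ 3 * ?b ^ 4 * ?c) \<le> 0"
    using pos by (simp add: ln_mult ln_realpow)
  then show ?thesis using pos by (subst (asm) ln_le_zero_iff) auto
qed

subsection \<open>The zeta function on the closed unit disc\<close>

context graded_primes
begin

lemma Nfps_nth_eq_card:
  "fps_nth (Nfps A) n = of_real (real (card {g \<in> free_on A. deg g = n}) / q ^ n)"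
  by (simp add: Nfps_def gf_nth)

lemma norm_Nfps_nth: "norm (fps_nth (Nfps A) n) = real (card {g \<in> free_on A. deg g = n}) / q ^ n"
  unfolding Nfps_nth_eq_card norm_of_real using q_pos by simp

lemma norm_Nfps_nth_mono: "A \<subseteq> B \<Longrightarrow> norm (fps_nth (Nfps A) n) \<le> norm (fps_nth (Nfps B) n)"
  unfolding norm_Nfps_nth using q_pos
  by (intro divide_right_mono of_nat_mono card_mono) (auto simp: free_on_def)

lemma norm_gf_nth_le:
  assumes "\<And>g. norm (w g) \<le> 1"
  shows "norm (fps_nth (gf w (free_on A)) n) \<le> norm (fps_nth (Nfps A) n)"
proof -
  have "norm (\<Sum>g\<in>{g \<in> free_on A. deg g = n}. w g) \<le> (\<Sum>g\<in>{g \<in> free_on A. deg g = n}. 1)"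
    by (intro order.trans[OF norm_sum] sum_mono assms)
  then show ?thesis
    using q_pos unfolding norm_Nfps_nth by (simp add: gf_nth norm_divide norm_power divide_right_mono)
qed

lemma norm_Mfps_nth_le: "norm (fps_nth (Mfps A) n) \<le> norm (fps_nth (Nfps A) n)"
  unfolding Mfps_def by (rule norm_gf_nth_le) (rule norm_mu_G_le)

lemma eval_one_minus_prime_fps:
  "fps_conv_radius (1 - prime_fps P) = \<infinity>"
  "eval_fps (1 - prime_fps P) z = 1 - (z / of_real q) ^ dg P"
proof -
  have p: "fps_conv_radius (prime_fps P) = \<infinity>" "eval_fps (prime_fps P) z = (z / of_real q) ^ dg P"
    unfolding prime_fps_def by (simp_all add: fps_conv_radius_cmult_left eval_fps_mult power_divide)
  show "fps_conv_radius (1 - prime_fps P) = \<infinity>"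
    using fps_conv_radius_diff[of 1 "prime_fps P"] p by simp
  show "eval_fps (1 - prime_fps P) z = 1 - (z / of_real q) ^ dg P"
    using p by (simp add: eval_fps_diff)
qed

lemma Mfps_finite_eval:
  assumes "finite A"
  shows "fps_conv_radius (Mfps A) = \<infinity>"
    and "eval_fps (Mfps A) z = (\<Prod>P\<in>A. 1 - (z / of_real q) ^ dg P)"
  using eval_fps_prod[of A "\<lambda>P. 1 - prime_fps P" z] assms
  by (simp_all add: Mfps_finite eval_one_minus_prime_fps)

text \<open>A multiple of P is determined by its degree because deg P > 0, so the n-th coefficient
  is at most q^(-n).\<close>

lemma Nfps_singleton_radius: "fps_conv_radius (Nfps {P}) \<ge> q"
proof -
  have "norm (fps_nth (Nfps {P}) n) \<le> 1 * (1 / q) ^ n" for n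
  proof -
    have "g = h" if "g \<in> free_on {P}" "h \<in> free_on {P}" "deg g = n" "deg h = n" for g h
    proof -
      have "x = replicate_mset (size x) P" if "x \<in> free_on {P}" for x
        using that by (auto simp: free_on_def set_mset_subset_singletonD)
      moreover have "deg (replicate_mset k P) = k * dg P" for k
        by (induction k) auto
      ultimately show ?thesis
        using that dg_pos[of P] by (metis mult_right_cancel neq0_conv)
    qed
    then have "card {g \<in> free_on {P}. deg g = n} \<le> 1"
      by (auto simp: card_le_Suc0_iff_eq)
    then show ?thesis
      unfolding norm_Nfps_nth using q_pos by (simp add: power_divide divide_right_mono)
  qed
  from fps_conv_radius_geometric_bound[OF this] show ?thesis using q_pos by simp
qed

lemma Nfps_finite_radius: "finite A \<Longrightarrow> fps_conv_radius (Nfps A) \<ge> q"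
proof (induction A rule: finite_induct)
  case (insert P A)
  then have "min (fps_conv_radius (Nfps {P})) (fps_conv_radius (Nfps A)) \<ge> q"
    using Nfps_singleton_radius by simp
  then show ?case
    using insert.hyps Nfps_Un[of "{P}" A] fps_conv_radius_mult[of "Nfps {P}" "Nfps A"]
    by (metis insert_is_Un order.trans Int_insert_left_if0 Int_empty_left)
qed simp

text \<open>Finitely many primes give a radius of convergence of at least q > 1, so the series
  converges at 1. Over all primes, by contrast, Axiom A# gives the limit c > 0.\<close>

lemma Nfps_finite_tendsto_0:
  assumes "finite A"
  shows "fps_nth (Nfps A) \<longlonglongrightarrow> 0"
proof -
  have "norm (1::complex) < fps_conv_radius (Nfps A)"
    by (rule less_le_trans[OF _ Nfps_finite_radius[OF assms]]) (use q_gt_1 in simp)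
  from summable_fps[OF this] show ?thesis by (simp add: summable_LIMSEQ_zero)
qed

end

section \<open>Axiom A# for the normalised zeta function\<close>

locale axiom_A = graded_primes dg q for dg :: "'p \<Rightarrow> nat" and q +
  fixes c C \<rho> :: real
  assumes c_pos: "c > 0" and \<rho>: "0 < \<rho>" "\<rho> < 1"
    and Nfps_asymp: "\<And>n. norm (fps_nth (Nfps UNIV) n - of_real c) \<le> C * \<rho> ^ n"
begin

text \<open>This is (1 - z) Z: the factor removes the pole at 1 and turns the coefficients into
  consecutive differences.\<close>

definition "Hfps = Nfps UNIV * (1 - fps_X)"

lemma C_nonneg: "C \<ge> 0"
  using order.trans[OF norm_ge_zero Nfps_asymp[of 0]] by simp

lemma Nfps_nth_bound: "norm (fps_nth (Nfps A) n) \<le> c + C"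
proof -
  have "norm (fps_nth (Nfps A) n) \<le> norm (fps_nth (Nfps UNIV) n)"
    by (rule norm_Nfps_nth_mono) simp
  also have "\<dots> \<le> norm (complex_of_real c) + norm (fps_nth (Nfps UNIV) n - of_real c)"
    by norm
  also have "\<dots> \<le> c + C * 1 ^ n"
    using c_pos C_nonneg \<rho> Nfps_asymp[of n]
    by (intro add_mono order.trans[OF Nfps_asymp] mult_left_mono power_mono) auto
  finally show ?thesis by simp
qed

lemma Nfps_radius: "fps_conv_radius (Nfps A) \<ge> 1"
  using fps_conv_radius_geometric_bound[of "Nfps A" "c + C" 1] Nfps_nth_bound by (simp add: one_ereal_def)

lemma Mfps_nth_bound: "norm (fps_nth (Mfps A) n) \<le> c + C"
  using norm_Mfps_nth_le Nfps_nth_bound order.trans by blast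

lemma Mfps_radius: "fps_conv_radius (Mfps A) \<ge> 1"
  using fps_conv_radius_geometric_bound[of "Mfps A" "c + C" 1] Mfps_nth_bound by (simp add: one_ereal_def)

lemma in_radius:
  assumes "norm (z::complex) < 1"
  shows "ereal (norm z) < fps_conv_radius (Nfps A)" "ereal (norm z) < fps_conv_radius (Mfps A)"
  by (rule less_le_trans[OF _ Nfps_radius] less_le_trans[OF _ Mfps_radius],
      use assms in \<open>simp add: one_ereal_def\<close>)+

lemma eval_Nfps_Mfps:
  assumes "norm z < 1"
  shows "eval_fps (Nfps A) z * eval_fps (Mfps A) z = 1"
  using eval_fps_mult[of z "Nfps A" "Mfps A"] in_radius[OF assms, of A] by (simp add: Nfps_Mfps)

lemma Nfps_tendsto: "fps_nth (Nfps UNIV) \<longlonglongrightarrow> of_real c"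
proof (rule LIM_zero_cancel, rule Lim_null_comparison)
  show "(\<lambda>n. C * \<rho> ^ n) \<longlonglongrightarrow> 0"
    using \<rho> by (intro tendsto_mult_right_zero LIMSEQ_realpow_zero) auto
qed (use Nfps_asymp in auto)

text \<open>The constant c cancels between consecutive coefficients, leaving two errors of at most C
  \<rho>^(n - 1). The summand 1 in the constant covers n = 0, where the coefficient is 1.\<close>

lemma norm_Hfps_nth_le: "norm (fps_nth Hfps n) \<le> (1 + 2 * C / \<rho>) * \<rho> ^ n"
proof (cases n)
  case 0
  have "fps_nth Hfps 0 = 1"
    unfolding Hfps_def one_minus_X_mult_nth Nfps_nth_eq_card
    by (simp add: free_on_def)
  then show ?thesis using 0 C_nonneg \<rho> by simp
next
  case (Suc m)
  let ?Z = "fps_nth (Nfps UNIV)"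
  have "norm (fps_nth Hfps n) = norm ((?Z n - of_real c) - (?Z m - of_real c))"
    unfolding Hfps_def one_minus_X_mult_nth by (simp add: Suc)
  also have "\<dots> \<le> C * \<rho> ^ n + C * \<rho> ^ m"
    by (intro order.trans[OF norm_triangle_ineq4] add_mono Nfps_asymp)
  also have "\<dots> \<le> C * \<rho> ^ m + C * \<rho> ^ m"
    using C_nonneg \<rho> Suc by (intro add_mono mult_left_mono power_decreasing) auto
  also have "\<dots> = (2 * C / \<rho>) * \<rho> ^ n" using \<rho> Suc by simp
  also have "\<dots> \<le> (1 + 2 * C / \<rho>) * \<rho> ^ n" using \<rho> by (intro mult_right_mono) auto
  finally show ?thesis .
qed

lemma Hfps_radius: "fps_conv_radius Hfps \<ge> 1 / \<rho>"
  by (rule fps_conv_radius_geometric_bound[OF norm_Hfps_nth_le]) (use \<rho> in simp)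

lemma in_Hfps_radius: "norm (z::complex) < 1 / \<rho> \<Longrightarrow> ereal (norm z) < fps_conv_radius Hfps"
  by (rule less_le_trans[OF _ Hfps_radius]) simp

lemma one_less_inverse_\<rho>: "1 < 1 / \<rho>"
  using \<rho> by simp

lemma eval_Hfps:
  assumes "norm z < 1"
  shows "eval_fps Hfps z = eval_fps (Nfps UNIV) z * (1 - z)"
proof -
  have "fps_conv_radius (1 - fps_X :: complex fps) = \<infinity>"
    using fps_conv_radius_diff[of 1 "fps_X :: complex fps"] by simp
  then show ?thesis
    unfolding Hfps_def using in_radius[OF assms] by (simp add: eval_fps_mult eval_fps_diff)
qed

lemma eval_Hfps_Mfps: "norm z < 1 \<Longrightarrow> eval_fps Hfps z * eval_fps (Mfps UNIV) z = 1 - z"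
  using eval_Nfps_Mfps[of z UNIV] by (simp add: eval_Hfps mult_ac)

lemma Hfps_ones: "Hfps * ones_fps = Nfps UNIV"
  using ones_fps_inverse by (simp add: Hfps_def mult_ac)

text \<open>The partial sums of the coefficients telescope to the coefficients of Z, which tend to
  c; the series converges at 1 because its radius exceeds 1.\<close>

lemma eval_Hfps_1: "eval_fps Hfps 1 = of_real c"
proof -
  have "(\<lambda>n. \<Sum>i\<le>n. fps_nth Hfps i) \<longlonglongrightarrow> of_real c"
    using Nfps_tendsto by (simp flip: mult_ones_fps_nth add: Hfps_ones)
  moreover have "fps_nth Hfps sums eval_fps Hfps 1"
    using sums_eval_fps[OF in_Hfps_radius, of 1] one_less_inverse_\<rho> by simp
  then have "(\<lambda>n. \<Sum>i\<le>n. fps_nth Hfps i) \<longlonglongrightarrow> eval_fps Hfps 1"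
    by (simp add: sums_def_le)
  ultimately show ?thesis using LIMSEQ_unique by blast
qed

text \<open>The infinite Euler product for 1 / Z as a limit of finite ones. Each coefficient is
  eventually constant in K, and (c + C) |z|^n dominates uniformly in K.\<close>

lemma Mfps_eval_tendsto:
  assumes z: "norm z < 1"
  shows "(\<lambda>K. eval_fps (Mfps {P. dg P \<le> K}) z) \<longlonglongrightarrow> eval_fps (Mfps UNIV) z"
  unfolding eval_fps_def
proof (rule conjunct2[OF conjunct2[OF tannerys_theorem[where M = "\<lambda>n. (c + C) * norm z ^ n"]]])
  fix n
  have "\<forall>\<^sub>F K in sequentially. fps_nth (Mfps UNIV) n * z ^ n = fps_nth (Mfps {P. dg P \<le> K}) n * z ^ n"
    using eventually_ge_at_top[of n]
  proof eventually_elim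
    case (elim K)
    then show ?case
      using gf_free_on_truncate[of n K _ UNIV] by (simp add: Mfps_def)
  qed
  then show "(\<lambda>K. fps_nth (Mfps {P. dg P \<le> K}) n * z ^ n) \<longlonglongrightarrow> fps_nth (Mfps UNIV) n * z ^ n"
    by (rule Lim_transform_eventually[OF tendsto_const])
  show "\<forall>\<^sub>F (n, K) in sequentially \<times>\<^sub>F sequentially.
      norm (fps_nth (Mfps {P. dg P \<le> K}) n * z ^ n) \<le> (c + C) * norm z ^ n"
    using Mfps_nth_bound by (intro always_eventually) (auto simp: norm_mult norm_power intro!: mult_right_mono)
  show "summable (\<lambda>n. (c + C) * norm z ^ n)"
    using z by (intro summable_mult summable_geometric) simp
qed simp

text \<open>Connects the Euler product of the theorem with the power series: its partial products
  are the inverses of the Moebius products over the primes of degree at most n + 1.\<close>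

lemma zetaG_eq_eval_Nfps:
  assumes z: "norm z < 1"
  shows "zetaG dg (z / of_real q) = eval_fps (Nfps UNIV) z"
proof -
  let ?f = "\<lambda>m. inverse ((1 - (z / of_real q) ^ Suc m) ^ card {P. dg P = Suc m})"
  have prod: "(\<Prod>m\<le>n. ?f m) = inverse (eval_fps (Mfps {P. dg P \<le> Suc n}) z)" for n
  proof -
    have "{P. dg P \<le> Suc n} = (\<Union>m\<le>n. {P. dg P = Suc m})"
    proof (rule set_eqI)
      fix P show "P \<in> {P. dg P \<le> Suc n} \<longleftrightarrow> P \<in> (\<Union>m\<le>n. {P. dg P = Suc m})"
        using dg_pos[of P] by (cases "dg P") auto
    qed
    then have "eval_fps (Mfps {P. dg P \<le> Suc n}) z = (\<Prod>P\<in>(\<Union>m\<le>n. {P. dg P = Suc m}). 1 - (z / of_real q) ^ dg P)"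
      using Mfps_finite_eval(2)[OF finite_dg_le, of "Suc n" z] by simp
    also have "\<dots> = (\<Prod>m\<le>n. \<Prod>P\<in>{P. dg P = Suc m}. 1 - (z / of_real q) ^ dg P)"
      by (rule prod.UNION_disjoint) (auto simp: finite_dg)
    also have "\<dots> = (\<Prod>m\<le>n. (1 - (z / of_real q) ^ Suc m) ^ card {P. dg P = Suc m})"
      by (intro prod.cong refl) simp
    finally show ?thesis by (simp add: prod_inversef[unfolded comp_def])
  qed
  have MN: "eval_fps (Mfps UNIV) z * eval_fps (Nfps UNIV) z = 1"
    using eval_Nfps_Mfps[OF z, of UNIV] by (simp add: mult.commute)
  then have nz: "eval_fps (Mfps UNIV) z \<noteq> 0" by auto
  have "(\<lambda>n. \<Prod>m\<le>n. ?f m) \<longlonglongrightarrow> inverse (eval_fps (Mfps UNIV) z)"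
    unfolding prod by (intro tendsto_inverse LIMSEQ_Suc[OF Mfps_eval_tendsto] z nz)
  \<comment> \<open>A convergent product must have a nonzero limit; an inverse of a nonzero number
    is one.\<close>
  then have "?f has_prod inverse (eval_fps (Mfps UNIV) z)"
    using nz by (simp add: has_prod_def raw_has_prod_def)
  then have "?f has_prod eval_fps (Nfps UNIV) z"
    by (simp only: inverse_unique[OF MN])
  then show ?thesis unfolding zetaG_def by (rule has_prod_unique[symmetric])
qed

text \<open>\<open>three_four_one\<close> holds for each Euler factor, with r = (x / q)^deg P and
  u^deg P in place of u; the limit over finite products preserves the bound.\<close>

lemma Mfps_three_four_one:
  assumes x: "0 \<le> x" "x < 1" and u: "norm u = 1"
  shows "norm (eval_fps (Mfps UNIV) (of_real x)) ^ 3 * norm (eval_fps (Mfps UNIV) (of_real x * u)) ^ 4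
    * norm (eval_fps (Mfps UNIV) (of_real x * u ^ 2)) \<le> 1"
proof (rule LIMSEQ_le_const2)
  let ?E = "\<lambda>K z. eval_fps (Mfps {P. dg P \<le> K}) z"
  show "(\<lambda>K. norm (?E K (of_real x)) ^ 3 * norm (?E K (of_real x * u)) ^ 4 * norm (?E K (of_real x * u ^ 2)))
    \<longlonglongrightarrow> norm (eval_fps (Mfps UNIV) (of_real x)) ^ 3 * norm (eval_fps (Mfps UNIV) (of_real x * u)) ^ 4
    * norm (eval_fps (Mfps UNIV) (of_real x * u ^ 2))"
    using x u by (intro tendsto_intros Mfps_eval_tendsto) (auto simp: norm_mult norm_power)
  have "norm (?E K (of_real x)) ^ 3 * norm (?E K (of_real x * u)) ^ 4 * norm (?E K (of_real x * u ^ 2)) \<le> 1" for K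
  proof -
    let ?A = "{P. dg P \<le> K}"
    let ?r = "\<lambda>P. (x / q) ^ dg P" and ?u = "\<lambda>P. u ^ dg P"
    have "norm (?E K (of_real x)) ^ 3 * norm (?E K (of_real x * u)) ^ 4 * norm (?E K (of_real x * u ^ 2))
      = (\<Prod>P\<in>?A. norm (1 - of_real (?r P) :: complex) ^ 3 * norm (1 - of_real (?r P) * ?u P) ^ 4
          * norm (1 - of_real (?r P) * ?u P ^ 2))"
      by (simp add: Mfps_finite_eval finite_dg_le prod.distrib prod_power_distrib power_divide
          power_mult_distrib mult.commute flip: prod_norm power_mult)
    also have "\<dots> \<le> 1"
    proof (intro prod_le_1 conjI three_four_one)
      fix P
      have "x / q < 1" using x q_gt_1 by (simp add: divide_less_eq)
      then show "?r P < 1" using x q_pos dg_pos by (auto simp: power_less_one_iff)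
    qed (use x q_pos u in \<open>auto simp: norm_power\<close>)
    finally show ?thesis .
  qed
  then show "\<exists>N. \<forall>K\<ge>N. norm (?E K (of_real x)) ^ 3 * norm (?E K (of_real x * u)) ^ 4
    * norm (?E K (of_real x * u ^ 2)) \<le> 1" by blast
qed

text \<open>Since |H| |M| = |1 - z| inside the disc, the upper bound for the Moebius series M turns
  into a lower bound for H.\<close>

lemma Hfps_three_four_one:
  assumes x: "0 \<le> x" "x < 1" and u: "norm u = 1"
  shows "(1 - x) ^ 3 * norm (1 - of_real x * u) ^ 4 * norm (1 - of_real x * u ^ 2) \<le>
    norm (eval_fps Hfps (of_real x)) ^ 3 * norm (eval_fps Hfps (of_real x * u)) ^ 4
      * norm (eval_fps Hfps (of_real x * u ^ 2))"
proof -
  let ?H = "\<lambda>z. norm (eval_fps Hfps z)" and ?M = "\<lambda>z. norm (eval_fps (Mfps UNIV) z)"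
  have HM: "?H z * ?M z = norm (1 - z)" if "norm z < 1" for z
    using eval_Hfps_Mfps[OF that] by (metis norm_mult)
  have "norm (1 - complex_of_real x) = 1 - x"
    using x by (metis abs_of_nonneg diff_ge_0_iff_ge less_imp_le norm_of_real of_real_1 of_real_diff)
  then have "(1 - x) ^ 3 * norm (1 - of_real x * u) ^ 4 * norm (1 - of_real x * u ^ 2)
    = (?H (of_real x) * ?M (of_real x)) ^ 3 * (?H (of_real x * u) * ?M (of_real x * u)) ^ 4
      * (?H (of_real x * u ^ 2) * ?M (of_real x * u ^ 2))"
    using x u by (subst (1 2 3) HM) (auto simp: norm_mult norm_power)
  also have "\<dots> = (?H (of_real x) ^ 3 * ?H (of_real x * u) ^ 4 * ?H (of_real x * u ^ 2))
      * (?M (of_real x) ^ 3 * ?M (of_real x * u) ^ 4 * ?M (of_real x * u ^ 2))"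
    by (simp add: power_mult_distrib mult_ac)
  also have "\<dots> \<le> (?H (of_real x) ^ 3 * ?H (of_real x * u) ^ 4 * ?H (of_real x * u ^ 2)) * 1"
    by (intro mult_left_mono Mfps_three_four_one x u) auto
  finally show ?thesis by simp
qed

lemma eval_Hfps_tendsto:
  assumes "norm z < 1 / \<rho>" and "f \<longlonglongrightarrow> z"
  shows "(\<lambda>n. eval_fps Hfps (f n)) \<longlonglongrightarrow> eval_fps Hfps z"
proof (rule isCont_tendsto_compose[OF _ assms(2)])
  show "isCont (eval_fps Hfps) z"
    using has_field_derivative_eval_fps[OF in_Hfps_radius[OF assms(1)]] DERIV_isCont by blast
qed

text \<open>If H(u) = 0, then H(xu) = O(1 - x) as x tends to 1 from below. Its fourth power beats
  the factor (1 - x)^3 of the 3-4-1 inequality, forcing |1 - u|^4 |1 - u^2| to be 0, which is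
  impossible for u other than 1 and -1.\<close>

lemma Hfps_nonzero_on_circle:
  assumes u: "norm u = 1" "u \<noteq> 1" "u \<noteq> -1"
  shows "eval_fps Hfps u \<noteq> 0"
proof
  assume zero: "eval_fps Hfps u = 0"
  define x where "x = (\<lambda>n. 1 - inverse (real (Suc n)))"
  define D where "D = eval_fps (fps_deriv Hfps) u"
  have u0: "u \<noteq> 0" using u by auto
  have x: "0 \<le> x n" "x n < 1" for n
    by (auto simp: x_def field_simps)
  have xlim: "x \<longlonglongrightarrow> 1"
    using tendsto_diff[OF tendsto_const[of 1] LIMSEQ_inverse_real_of_nat] by (simp add: x_def)
  have xc: "(\<lambda>n. of_real (x n)) \<longlonglongrightarrow> (1 :: complex)"
    using tendsto_of_real[OF xlim] by simp
  have xu: "(\<lambda>n. of_real (x n) * u) \<longlonglongrightarrow> u" "(\<lambda>n. of_real (x n) * u ^ 2) \<longlonglongrightarrow> u ^ 2"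
    using tendsto_mult_right[OF xc] by (metis mult_1)+
  have "((\<lambda>w. (eval_fps Hfps w - eval_fps Hfps u) / (w - u)) \<longlongrightarrow> D) (at u)"
    using has_field_derivative_eval_fps[OF in_Hfps_radius, of u UNIV] u one_less_inverse_\<rho>
    by (simp add: D_def has_field_derivative_iff)
  then have "(\<lambda>n. (eval_fps Hfps (of_real (x n) * u) - eval_fps Hfps u) / (of_real (x n) * u - u)) \<longlonglongrightarrow> D"
  proof (rule filterlim_compose)
    have "of_real (x n) * u \<noteq> u" for n
      using x(2)[of n] u0 by simp
    then show "filterlim (\<lambda>n. of_real (x n) * u) (at u) sequentially"
      using xu(1) by (simp add: filterlim_at)
  qed
  then have "(\<lambda>n. norm (eval_fps Hfps (of_real (x n) * u) / (of_real (x n) * u - u))) \<longlonglongrightarrow> norm D"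
    unfolding zero diff_0_right by (rule tendsto_norm)
  moreover have "norm (eval_fps Hfps (of_real (x n) * u) / (of_real (x n) * u - u))
      = norm (eval_fps Hfps (of_real (x n) * u)) / (1 - x n)" for n
  proof -
    have "of_real (x n) * u - u = of_real (x n - 1) * u" by (simp add: algebra_simps)
    then have "norm (of_real (x n) * u - u) = 1 - x n"
      using u x(2)[of n] by (simp only: norm_mult norm_of_real) simp
    then show ?thesis by (simp add: norm_divide)
  qed
  ultimately have quot: "(\<lambda>n. norm (eval_fps Hfps (of_real (x n) * u)) / (1 - x n)) \<longlonglongrightarrow> norm D"
    by simp
  let ?lhs = "\<lambda>n. norm (1 - of_real (x n) * u) ^ 4 * norm (1 - of_real (x n) * u ^ 2)"
  \<comment> \<open>The inequality divided by (1 - x)^3: of the four factors 1 - x hidden in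
    |H(xu)|^4 one survives, and it makes the limit 0.\<close>
  let ?rhs = "\<lambda>n. norm (eval_fps Hfps (of_real (x n))) ^ 3 *
      (norm (eval_fps Hfps (of_real (x n) * u)) / (1 - x n)) ^ 4 * (1 - x n) *
      norm (eval_fps Hfps (of_real (x n) * u ^ 2))"
  have "?lhs n \<le> ?rhs n" for n
  proof -
    have "(1 - x n) ^ 3 * ?lhs n \<le> (1 - x n) ^ 3 * ?rhs n"
      using Hfps_three_four_one[OF x u(1), of n] x(2)[of n]
      by (simp add: power_divide divide_simps) (simp add: mult_ac power_numeral_reduce)
    then show ?thesis using x(2)[of n] by (simp only: mult_le_cancel_left) simp
  qed
  moreover have "?lhs \<longlonglongrightarrow> norm (1 - u) ^ 4 * norm (1 - u ^ 2)"
    by (intro tendsto_intros xu)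
  moreover have "?rhs \<longlonglongrightarrow> norm (eval_fps Hfps 1) ^ 3 * norm D ^ 4 * (1 - 1) * norm (eval_fps Hfps (u ^ 2))"
    using u one_less_inverse_\<rho>
    by (intro tendsto_intros quot xlim eval_Hfps_tendsto xu xc) (auto simp: norm_power)
  ultimately have "norm (1 - u) ^ 4 * norm (1 - u ^ 2)
      \<le> norm (eval_fps Hfps 1) ^ 3 * norm D ^ 4 * (1 - 1) * norm (eval_fps Hfps (u ^ 2))"
    by (intro LIMSEQ_le) auto
  moreover have "norm (1 - u) ^ 4 * norm (1 - u ^ 2) > 0"
    using u by (auto simp: power2_eq_1_iff)
  ultimately show False by simp
qed

text \<open>H agrees with (1 - z) F on the unit disc, and the identity theorem extends this to the
  connected punctured disc, which contains -1.\<close>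

lemma Hfps_minus_one_nonzero:
  assumes hol: "F holomorphic_on ball 0 (1 / \<rho>) - {1}"
    and F: "\<And>z. norm z < 1 \<Longrightarrow> F z = eval_fps (Nfps UNIV) z" and nz: "F (-1) \<noteq> 0"
  shows "eval_fps Hfps (-1) \<noteq> 0"
proof -
  have "eval_fps Hfps (-1) = F (-1) * (1 - (-1))"
  proof (rule analytic_continuation_open[where s = "ball 0 1" and s' = "ball 0 (1 / \<rho>) - {1}"
        and f = "eval_fps Hfps" and g = "\<lambda>z. F z * (1 - z)"])
    show "connected (ball (0::complex) (1 / \<rho>) - {1})"
      by (intro connected_open_delete) auto
    show "eval_fps Hfps holomorphic_on ball 0 (1 / \<rho>) - {1}"
      by (intro holomorphic_intros) (auto intro!: in_Hfps_radius)
    show "(\<lambda>z. F z * (1 - z)) holomorphic_on ball 0 (1 / \<rho>) - {1}"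
      by (intro holomorphic_intros hol)
  qed (use one_less_inverse_\<rho> F eval_Hfps in auto)
  then show ?thesis using nz by simp
qed

end

section \<open>Absolute summability of 1 / H and Moebius sums over primes of large degree\<close>

locale axiom_A_nonzero = axiom_A dg q c C \<rho> for dg :: "'p \<Rightarrow> nat" and q c C \<rho> +
  assumes Hfps_m1: "eval_fps Hfps (-1) \<noteq> 0"
begin

lemma Hfps_nonzero_cball: "norm z \<le> 1 \<Longrightarrow> eval_fps Hfps z \<noteq> 0"
proof -
  assume z: "norm z \<le> 1"
  show ?thesis
  proof (cases "norm z < 1")
    case True
    then have "1 - z \<noteq> 0" by auto
    then show ?thesis using eval_Hfps_Mfps[OF True] by auto
  next
    case False
    then have "norm z = 1" using z by simp
    then show ?thesis
      using Hfps_nonzero_on_circle[of z] Hfps_m1 eval_Hfps_1 c_pos by fastforce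
  qed
qed

text \<open>The closed unit disc is compact and lies in an open set on which H is nonzero, so a
  uniform margin around it does too.\<close>

lemma Hfps_nonzero_disc: "\<exists>r>1. \<forall>z. norm z < r \<longrightarrow> eval_fps Hfps z \<noteq> 0"
proof -
  let ?V = "{z \<in> ball 0 (1 / \<rho>). eval_fps Hfps z \<in> - {0}}"
  have cont: "continuous_on (ball 0 (1 / \<rho>)) (eval_fps Hfps)"
    by (rule continuous_on_subset[OF continuous_on_eval_fps]) (auto intro!: in_Hfps_radius)
  have "open ?V"
    using continuous_open_preimage[OF cont open_ball open_Compl[OF closed_singleton[of 0]]]
    by (simp add: vimage_def Int_def)
  moreover have "cball 0 1 \<subseteq> ?V"
    using one_less_inverse_\<rho> Hfps_nonzero_cball by auto
  ultimately obtain e where e: "e > 0" "(\<Union>x\<in>cball 0 1. ball x e) \<subseteq> ?V"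
    using compact_subset_open_imp_ball_epsilon_subset[of "cball 0 1" ?V] by auto
  have "eval_fps Hfps z \<noteq> 0" if z: "norm z < 1 + e" for z
  proof (cases "norm z \<le> 1")
    case False
    \<comment> \<open>\<open>sgn z\<close> is the radial projection of z to the unit circle, at
      distance |z| - 1.\<close>
    have "dist (sgn z) z < e"
    proof -
      have "z \<noteq> 0" using False by auto
      then have "sgn z - z = of_real (1 - norm z) * sgn z"
        by (simp add: sgn_eq field_simps)
      then have "dist (sgn z) z = \<bar>1 - norm z\<bar>"
        using \<open>z \<noteq> 0\<close> by (simp only: dist_norm norm_mult norm_of_real norm_sgn) simp
      then show ?thesis using z False by simp
    qed
    moreover have "sgn z \<in> cball 0 1" by (simp add: norm_sgn)
    ultimately show ?thesis using e(2) by fastforce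
  qed (use Hfps_nonzero_cball in auto)
  then show ?thesis using e(1) by (intro exI[of _ "1 + e"]) auto
qed

text \<open>The series of partial sums of the normalised Moebius sums; it equals 1 / ((1 - z) Z) = 1
  / H.\<close>

definition "Tfps = Mfps UNIV * ones_fps"

lemma Tfps_eq_inverse: "Tfps = inverse Hfps"
proof -
  have "Hfps * Tfps = (Nfps UNIV * Mfps UNIV) * (ones_fps * (1 - fps_X))"
    by (simp add: Hfps_def Tfps_def mult_ac)
  then have "Hfps * Tfps = 1" by (simp add: Nfps_Mfps ones_fps_inverse)
  then show ?thesis by (metis fps_inverse_unique)
qed

text \<open>H has no zero in a disc of radius above 1, so the power series of 1 / H converges
  absolutely at 1, with value 1 / H(1) = 1 / c.\<close>

lemma Tfps_summable: "summable (\<lambda>n. norm (fps_nth Tfps n))"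
  and Tfps_suminf: "suminf (fps_nth Tfps) = 1 / of_real c"
proof -
  obtain r where r: "r > 1" "\<And>z. norm z < r \<Longrightarrow> eval_fps Hfps z \<noteq> 0"
    using Hfps_nonzero_disc by blast
  have 1: "norm (1::complex) < fps_conv_radius Hfps"
    by (rule in_Hfps_radius) (use one_less_inverse_\<rho> in simp)
  have "min (ereal r) (fps_conv_radius Hfps) \<le> fps_conv_radius Tfps"
    unfolding Tfps_eq_inverse by (rule fps_conv_radius_inverse) (use r in auto)
  moreover have "norm (1::complex) < min (ereal r) (fps_conv_radius Hfps)"
    using r 1 by simp
  ultimately have "norm (1::complex) < fps_conv_radius Tfps" by (rule less_le_trans[rotated])
  from norm_summable_fps[OF this] show "summable (\<lambda>n. norm (fps_nth Tfps n))" by simp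
  have "eval_fps Tfps 1 = inverse (eval_fps Hfps 1)"
    unfolding Tfps_eq_inverse by (rule eval_fps_inverse[of r]) (use r 1 in auto)
  then show "suminf (fps_nth Tfps) = 1 / of_real c"
    unfolding eval_Hfps_1 by (simp add: eval_fps_def divide_inverse)
qed

text \<open>Removing the Euler factors of degree at most m from 1 / Z means multiplying by the
  finite zeta product over these primes.\<close>

lemma Mfps_gt: "Mfps {P. dg P > m} = Nfps {P. dg P \<le> m} * Mfps UNIV"
proof -
  have "{P. dg P \<le> m} \<union> {P. dg P > m} = UNIV" "{P. dg P \<le> m} \<inter> {P. dg P > m} = {}" by auto
  then have "Mfps UNIV = Mfps {P. dg P \<le> m} * Mfps {P. dg P > m}" by (metis Mfps_Un)
  then have "Nfps {P. dg P \<le> m} * Mfps UNIV = (Nfps {P. dg P \<le> m} * Mfps {P. dg P \<le> m}) * Mfps {P. dg P > m}"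
    by (simp only: mult.assoc)
  then show ?thesis by (simp add: Nfps_Mfps)
qed

lemma Mfps_gt_ones: "Mfps {P. dg P > m} * ones_fps = Tfps * Nfps {P. dg P \<le> m}"
  by (simp add: Mfps_gt Tfps_def mult_ac)

definition "T_bound = (\<Sum>n. norm (fps_nth Tfps n)) * (c + C)"

text \<open>Uniform in m as well as in n, because c + C bounds the zeta coefficients of every set of
  primes.\<close>

lemma norm_Mfps_gt_ones_le: "norm (fps_nth (Mfps {P. dg P > m} * ones_fps) n) \<le> T_bound"
  unfolding Mfps_gt_ones T_bound_def by (intro norm_fps_mult_nth_le Tfps_summable Nfps_nth_bound)

text \<open>For fixed m the summable kernel \<open>Tfps\<close> is convolved with the zeta
  coefficients of finitely many primes, a null sequence.\<close>

lemma Mfps_gt_ones_tendsto_0: "fps_nth (Mfps {P. dg P > m} * ones_fps) \<longlonglongrightarrow> 0"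
  using fps_mult_nth_tendsto[OF Tfps_summable Nfps_finite_tendsto_0[OF finite_dg_le[of m]]]
  by (simp add: Mfps_gt_ones)

end

section \<open>An upper bound of Mertens type\<close>

context axiom_A
begin

text \<open>Comparing the truncated Euler product at \<open>x = 1 - 1 / (2 * d)\<close>, where \<open>x ^ d \<ge> 1 / 2\<close>, with
  the trivial bound \<open>(c + C) / (1 - x)\<close> for its power series.\<close>

lemma Mertens_bound:
  assumes d: "d \<ge> 1"
  shows "(\<Sum>P\<in>{P. dg P \<le> d}. 1 / q ^ dg P) \<le> 2 * ln (2 * (c + C)) + 2 * ln (real d)"
proof -
  define x where "x = 1 - 1 / (2 * real d)"
  let ?A = "{P. dg P \<le> d}"
  have x: "0 \<le> x" "x < 1" using d by (auto simp: x_def field_simps)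
  have "1 + real d * (- 1 / (2 * real d)) \<le> (1 + - 1 / (2 * real d)) ^ d"
    using d by (intro Bernoulli_inequality) (auto simp: field_simps)
  then have xd: "1 / 2 \<le> x ^ d" using d by (simp add: x_def)
  have lt1: "(x / q) ^ dg P < 1" for P
  proof -
    have "x / q < 1" using x q_gt_1 by (simp add: divide_less_eq)
    then show ?thesis using x q_pos dg_pos by (auto simp: power_less_one_iff)
  qed
  have cC: "c + C > 0" using c_pos C_nonneg by simp
  have nx: "norm (complex_of_real x) < 1" using x by simp
  have "norm (eval_fps (Nfps ?A) (of_real x)) \<le> (\<Sum>n. (c + C) * x ^ n)"
    unfolding eval_fps_def
  proof (rule norm_suminf_le)
    show "norm (fps_nth (Nfps ?A) n * of_real x ^ n) \<le> (c + C) * x ^ n" for n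
      using x Nfps_nth_bound by (auto simp: norm_mult norm_power intro!: mult_right_mono)
    show "summable (\<lambda>n. (c + C) * x ^ n)"
      using x by (intro summable_mult summable_geometric) simp
  qed
  also have "\<dots> = (c + C) * (2 * real d)"
    using x d by (subst suminf_mult) (auto simp: suminf_geometric x_def intro!: summable_geometric)
  finally have upper: "norm (eval_fps (Nfps ?A) (of_real x)) \<le> (c + C) * (2 * real d)" .
  \<comment> \<open>By e^y \<le> 1 / (1 - y), the exponential of the prime sum is at most the Euler
    product.\<close>
  have "exp (\<Sum>P\<in>?A. (x / q) ^ dg P) = (\<Prod>P\<in>?A. exp ((x / q) ^ dg P))"
    by (simp add: exp_sum finite_dg_le)
  also have "\<dots> \<le> (\<Prod>P\<in>?A. 1 / (1 - (x / q) ^ dg P))"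
  proof (intro prod_mono conjI)
    fix P
    have "exp y \<le> 1 / (1 - y)" if "y < 1" for y :: real
      using exp_ge_add_one_self[of "- y"] that by (simp add: exp_minus field_simps)
    then show "exp ((x / q) ^ dg P) \<le> 1 / (1 - (x / q) ^ dg P)" using lt1[of P] .
  qed simp
  also have "\<dots> = norm (eval_fps (Nfps ?A) (of_real x))"
  proof -
    have "norm (1 - (complex_of_real x / of_real q) ^ dg P) = 1 - (x / q) ^ dg P" for P
    proof -
      have "1 - (complex_of_real x / of_real q) ^ dg P = of_real (1 - (x / q) ^ dg P)" by simp
      then show ?thesis using lt1[of P] by (simp only: norm_of_real)
    qed
    then have "norm (eval_fps (Mfps ?A) (of_real x)) = (\<Prod>P\<in>?A. 1 - (x / q) ^ dg P)"
      by (simp add: Mfps_finite_eval finite_dg_le flip: prod_norm)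
    moreover have "norm (eval_fps (Nfps ?A) (of_real x)) * norm (eval_fps (Mfps ?A) (of_real x)) = 1"
      using eval_Nfps_Mfps[OF nx, of ?A] by (metis norm_mult norm_one)
    ultimately show ?thesis
      by (simp add: prod_dividef) (metis inverse_eq_divide inverse_unique mult.commute)
  qed
  finally have "exp (\<Sum>P\<in>?A. (x / q) ^ dg P) \<le> (c + C) * (2 * real d)" using upper by simp
  then have "(\<Sum>P\<in>?A. (x / q) ^ dg P) \<le> ln ((c + C) * (2 * real d))"
    using cC d by (subst ln_ge_iff) auto
  also have "\<dots> = ln (2 * (c + C)) + ln (real d)"
    using cC d ln_mult_pos[of "2 * (c + C)" "real d"] by (simp add: mult_ac)
  finally have "2 * (\<Sum>P\<in>?A. (x / q) ^ dg P) \<le> 2 * ln (2 * (c + C)) + 2 * ln (real d)" by simp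
  \<comment> \<open>Removing the weights x^deg P costs at most a factor 2, as x^deg P \<ge> x^d
    \<ge> 1 / 2.\<close>
  moreover have "(\<Sum>P\<in>?A. 1 / q ^ dg P) \<le> 2 * (\<Sum>P\<in>?A. (x / q) ^ dg P)"
    unfolding sum_distrib_left
  proof (rule sum_mono)
    fix P assume "P \<in> ?A"
    then have "x ^ d \<le> x ^ dg P" using x by (intro power_decreasing) auto
    then have "1 \<le> 2 * x ^ dg P" using xd by simp
    then show "1 / q ^ dg P \<le> 2 * (x / q) ^ dg P"
      using q_pos by (simp add: power_divide divide_right_mono)
  qed
  ultimately show ?thesis by simp
qed

end

subsection \<open>Sorting by the distinguished prime\<close>

text \<open>Replaces the minimum and the definite description by a direct criterion.
  Distinguishability concerns the set of prime divisors, so the distinguished prime may have any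
  positive multiplicity.\<close>

lemma Dset_iff:
  "g \<in> Dset dg S \<longleftrightarrow> g = {#} \<or> (\<exists>Q\<in>S. Q \<in># g \<and> (\<forall>P\<in>#g. P \<noteq> Q \<longrightarrow> dg Q < dg P))"
proof (cases "g = {#}")
  case False
  have "distinguishable dg g \<and> P_min dg g \<in> S" if Q: "Q \<in> S" "Q \<in># g" "\<forall>P\<in>#g. P \<noteq> Q \<longrightarrow> dg Q < dg P" for Q
  proof -
    have m: "d_minus dg g = dg Q"
      unfolding d_minus_def using Q by (intro Min_eqI) (auto intro: less_imp_le)
    have uniq: "P = Q" if "P \<in># g \<and> dg P = d_minus dg g" for P
      using that Q(3) m by fastforce
    then have "\<exists>!P. P \<in># g \<and> dg P = d_minus dg g"
      using Q(2) m by (intro ex1I[of _ Q]) auto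
    moreover have "P_min dg g = Q"
      unfolding P_min_def by (rule the_equality[OF _ uniq]) (use Q(2) m in auto)
    ultimately show ?thesis using False Q(1) by (simp add: distinguishable_def)
  qed
  moreover have "\<exists>Q\<in>S. Q \<in># g \<and> (\<forall>P\<in>#g. P \<noteq> Q \<longrightarrow> dg Q < dg P)"
    if D: "distinguishable dg g" "P_min dg g \<in> S"
  proof (intro bexI conjI ballI impI)
    have 1: "P_min dg g \<in># g \<and> dg (P_min dg g) = d_minus dg g"
      unfolding P_min_def by (rule theI') (use D(1) in \<open>simp add: distinguishable_def\<close>)
    then show "P_min dg g \<in># g" by simp
    fix P assume P: "P \<in># g" "P \<noteq> P_min dg g"
    then have "d_minus dg g \<le> dg P" unfolding d_minus_def by (intro Min_le) auto
    moreover have "d_minus dg g \<noteq> dg P"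
      using D(1) P 1 unfolding distinguishable_def by metis
    ultimately show "dg (P_min dg g) < dg P" using 1 by simp
  qed (use D in auto)
  ultimately show ?thesis using False by (auto simp: Dset_def)
qed (simp add: Dset_def)

lemma d_minus_eqI:
  assumes "Q \<in># g" "\<And>P. P \<in># g \<Longrightarrow> P \<noteq> Q \<Longrightarrow> dg Q < dg P"
  shows "d_minus dg g = dg Q"
  unfolding d_minus_def using assms by (intro Min_eqI) (auto intro: less_imp_le)

context graded_primes
begin

text \<open>The elements with distinguished prime \<open>Q\<close> of multiplicity one. Those in
  which \<open>Q\<close> repeats have Moebius value 0 and are left out.\<close>

definition with_min_prime :: "'p \<Rightarrow> 'p multiset set" where
  "with_min_prime Q = add_mset Q ` free_on {P. dg P > dg Q}"

lemma with_min_primeD: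
  assumes "g \<in> with_min_prime Q"
  shows "Q \<in># g" "\<And>P. P \<in># g \<Longrightarrow> P \<noteq> Q \<Longrightarrow> dg Q < dg P"
  using assms by (auto simp: with_min_prime_def free_on_def)

lemma with_min_primeI:
  assumes "Q \<in># g" "count g Q \<le> 1" "\<And>P. P \<in># g \<Longrightarrow> P \<noteq> Q \<Longrightarrow> dg Q < dg P"
  shows "g \<in> with_min_prime Q"
proof -
  from assms(1) obtain r where r: "g = add_mset Q r" by (metis insert_DiffM)
  have "Q \<notin># r" using assms(2) by (simp add: r count_eq_zero_iff)
  then show ?thesis using assms(3) by (auto simp: r with_min_prime_def free_on_def)
qed

lemma mu_G_add_min_prime:
  assumes "r \<in> free_on {P. dg P > dg Q}"
  shows "mu_G (add_mset Q r) = - mu_G r"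
  using mu_G_add_disjoint[of "{#Q#}" r] assms by (auto simp: free_on_def)

text \<open>Splitting off the distinguished prime flips the sign of the Moebius function and leaves
  a free sum over primes of larger degree. The weight \<open>w\<close> is kept general because in
  the cofactor sums it also involves a fixed element h.\<close>

lemma gf_UN_with_min_prime:
  assumes U: "finite U"
    and w: "\<And>Q r. Q \<in> U \<Longrightarrow> r \<in> free_on {P. dg P > dg Q} \<Longrightarrow> w (add_mset Q r) = - f (dg Q) * of_int (mu_G r)"
  shows "gf w (\<Union>Q\<in>U. with_min_prime Q) =
    - (\<Sum>Q\<in>U. fps_const (f (dg Q)) * prime_fps Q * Mfps {P. dg P > dg Q})"
proof -
  have "disjoint_family_on with_min_prime U"
  proof (unfold disjoint_family_on_def, intro ballI impI equals0I)
    fix Q Q' g assume "Q \<noteq> Q'" "g \<in> with_min_prime Q \<inter> with_min_prime Q'"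
    then have "dg Q < dg Q'" "dg Q' < dg Q"
      using with_min_primeD[of g Q] with_min_primeD[of g Q'] by auto
    then show False by simp
  qed
  then have "gf w (\<Union>Q\<in>U. with_min_prime Q) = (\<Sum>Q\<in>U. gf w (with_min_prime Q))"
    using U by (rule gf_UN[rotated])
  also have "\<dots> = (\<Sum>Q\<in>U. - (fps_const (f (dg Q)) * prime_fps Q * Mfps {P. dg P > dg Q}))"
  proof (rule sum.cong)
    fix Q assume Q: "Q \<in> U"
    have "gf w (with_min_prime Q) = fps_const (- f (dg Q)) * prime_fps Q * Mfps {P. dg P > dg Q}"
      unfolding with_min_prime_def Mfps_def by (rule gf_add_prime) (rule w[OF Q])
    then show "gf w (with_min_prime Q) = - (fps_const (f (dg Q)) * prime_fps Q * Mfps {P. dg P > dg Q})"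
      by (simp flip: fps_const_neg)
  qed simp
  finally show ?thesis by (simp add: sum_negf)
qed

definition Dgf :: "'p set \<Rightarrow> ('p multiset \<Rightarrow> complex) \<Rightarrow> complex fps" where
  "Dgf S w = gf w (Dset dg S - {{#}})"

lemma sum_deg_le_eq:
  "(\<Sum>g\<in>{g \<in> X. deg g \<le> n}. w g / complex_of_real (q ^ deg g)) = fps_nth (gf w X * ones_fps) n"
proof -
  have fin: "finite {g \<in> X. deg g \<le> n}"
    by (rule finite_subset[OF _ finite_deg_le[of n]]) auto
  have "(\<Sum>g\<in>{g \<in> X. deg g \<le> n}. w g / complex_of_real (q ^ deg g))
      = (\<Sum>m\<le>n. \<Sum>g\<in>{g \<in> {g \<in> X. deg g \<le> n}. deg g = m}. w g / complex_of_real (q ^ deg g))"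
    by (rule sum.group[symmetric]) (use fin in auto)
  also have "\<dots> = (\<Sum>m\<le>n. fps_nth (gf w X) m)"
  proof (rule sum.cong)
    fix m assume "m \<in> {..n}"
    then have "{g \<in> {g \<in> X. deg g \<le> n}. deg g = m} = {g \<in> X. deg g = m}" by auto
    then show "(\<Sum>g\<in>{g \<in> {g \<in> X. deg g \<le> n}. deg g = m}. w g / complex_of_real (q ^ deg g))
      = fps_nth (gf w X) m" by (simp add: gf_nth sum_divide_distrib)
  qed simp
  finally show ?thesis by (simp add: mult_ones_fps_nth)
qed

lemma Dset_deg_between: "{g. 1 \<le> deg g \<and> deg g \<le> n \<and> g \<in> Dset dg S} = {g \<in> Dset dg S - {{#}}. deg g \<le> n}"
proof -
  have "1 \<le> deg g \<longleftrightarrow> g \<noteq> {#}" for g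
    using deg_eq_0_iff[of g] by linarith
  then show ?thesis by auto
qed

lemma Dgf_sum:
  "(\<Sum>g\<in>{g. 1 \<le> deg g \<and> deg g \<le> n \<and> g \<in> Dset dg S}. w g / complex_of_real (q ^ deg g))
    = fps_nth (Dgf S w * ones_fps) n"
  unfolding Dset_deg_between Dgf_def by (rule sum_deg_le_eq)

text \<open>Any cutoff K \<ge> n gives the same coefficient, so inside a product one finite sum
  serves for all indices up to K.\<close>

lemma Dgf_mu_nth:
  assumes "n \<le> K"
  shows "fps_nth (Dgf S (\<lambda>g. of_int (mu_G g) * f (d_minus dg g))) n =
    - fps_nth (\<Sum>Q\<in>{Q \<in> S. dg Q \<le> K}. fps_const (f (dg Q)) * prime_fps Q * Mfps {P. dg P > dg Q}) n"
proof -
  let ?U = "{Q \<in> S. dg Q \<le> K}" and ?w = "\<lambda>g. of_int (mu_G g) * f (d_minus dg g)"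
  have fin: "finite ?U" by (rule finite_subset[OF _ finite_dg_le[of K]]) auto
  have "fps_nth (Dgf S ?w) n = fps_nth (gf ?w (\<Union>Q\<in>?U. with_min_prime Q)) n"
    unfolding Dgf_def
  proof (rule gf_nth_cong)
    fix g assume g: "deg g = n" "g \<in> Dset dg S - {{#}}"
    show "g \<in> (\<Union>Q\<in>?U. with_min_prime Q) \<or> ?w g = 0"
    proof (rule disjCI)
      assume "?w g \<noteq> 0"
      then have "mu_G g \<noteq> 0" by auto
      from g obtain Q where Q: "Q \<in> S" "Q \<in># g" "\<forall>P\<in>#g. P \<noteq> Q \<longrightarrow> dg Q < dg P"
        by (auto simp: Dset_iff)
      then have "g \<in> with_min_prime Q"
        using mu_G_nonzeroD[OF \<open>mu_G g \<noteq> 0\<close>] by (intro with_min_primeI) auto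
      moreover have "dg Q \<le> K" using dg_le_deg[OF Q(2)] g assms by simp
      ultimately show "g \<in> (\<Union>Q\<in>?U. with_min_prime Q)" using Q(1) by auto
    qed
  next
    fix g assume "g \<in> (\<Union>Q\<in>?U. with_min_prime Q)"
    then obtain Q where Q: "Q \<in> S" "g \<in> with_min_prime Q" by auto
    then show "g \<in> Dset dg S - {{#}} \<or> ?w g = 0"
      using with_min_primeD[OF Q(2)] by (auto simp: Dset_iff)
  qed simp
  also have "gf ?w (\<Union>Q\<in>?U. with_min_prime Q) =
      - (\<Sum>Q\<in>?U. fps_const (f (dg Q)) * prime_fps Q * Mfps {P. dg P > dg Q})"
  proof (rule gf_UN_with_min_prime[OF fin])
    fix Q r assume r: "r \<in> free_on {P. dg P > dg Q}"
    then have "add_mset Q r \<in> with_min_prime Q" by (auto simp: with_min_prime_def)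
    then have "d_minus dg (add_mset Q r) = dg Q"
      by (intro d_minus_eqI) (auto dest: with_min_primeD)
    then show "?w (add_mset Q r) = - f (dg Q) * of_int (mu_G r)"
      by (simp add: mu_G_add_min_prime[OF r])
  qed
  finally show ?thesis by simp
qed

section \<open>Largest primes and their duality with smallest primes\<close>

definition max_gf :: "'p set \<Rightarrow> (nat \<Rightarrow> complex) \<Rightarrow> complex fps" where
  "max_gf S f = gf (\<lambda>g. of_nat (Q_S dg S g) * f (d_plus dg g)) UNIV"

text \<open>Once one copy of \<open>Q\<close> is removed, the cofactor is any element over primes of
  degree at most deg Q; it may contain \<open>Q\<close> again or other primes of the same
  degree.\<close>

lemma max_prime_set_eq:
  "{g. Q \<in># g \<and> dg Q = d_plus dg g} = add_mset Q ` free_on {P. dg P \<le> dg Q}"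
proof (intro equalityI subsetI)
  fix g assume "g \<in> {g. Q \<in># g \<and> dg Q = d_plus dg g}"
  then have g: "Q \<in># g" "dg Q = Max (dg ` set_mset g)"
    by (auto simp: d_plus_def split: if_splits)
  then have "\<forall>P\<in>#g. dg P \<le> dg Q" by simp
  then have "g - {#Q#} \<in> free_on {P. dg P \<le> dg Q}" by (auto simp: free_on_def dest: in_diffD)
  then show "g \<in> add_mset Q ` free_on {P. dg P \<le> dg Q}" using g(1) by (metis image_eqI insert_DiffM)
next
  fix g assume "g \<in> add_mset Q ` free_on {P. dg P \<le> dg Q}"
  then obtain r where r: "g = add_mset Q r" "\<forall>P\<in>#r. dg P \<le> dg Q" by (auto simp: free_on_def)
  then have "Max (dg ` set_mset g) = dg Q" by (intro Max_eqI) auto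
  then show "g \<in> {g. Q \<in># g \<and> dg Q = d_plus dg g}" using r(1) by (simp add: d_plus_def)
qed

text \<open>\<open>Q_S\<close> counts the primes of S of maximal degree, so the coefficient is a sum
  over pairs (g, Q); exchanging the order of summation sorts it by Q.\<close>

lemma max_gf_nth:
  "fps_nth (max_gf S f) n =
    fps_nth (\<Sum>Q\<in>{Q \<in> S. dg Q \<le> n}. fps_const (f (dg Q)) * prime_fps Q * Nfps {P. dg P \<le> dg Q}) n"
proof -
  let ?U = "{Q \<in> S. dg Q \<le> n}" and ?G = "{g. deg g = n}"
  have fin: "finite ?U" by (rule finite_subset[OF _ finite_dg_le[of n]]) auto
  have "(\<Sum>g\<in>?G. of_nat (Q_S dg S g) * f (d_plus dg g))
      = (\<Sum>g\<in>?G. \<Sum>Q\<in>{Q \<in> ?U. Q \<in># g \<and> dg Q = d_plus dg g}. f (dg Q))"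
  proof (rule sum.cong)
    fix g assume "g \<in> ?G"
    then have "{P \<in> S. P \<in># g \<and> dg P = d_plus dg g} = {Q \<in> ?U. Q \<in># g \<and> dg Q = d_plus dg g}"
      using dg_le_deg[of _ g] by auto
    then show "of_nat (Q_S dg S g) * f (d_plus dg g) = (\<Sum>Q\<in>{Q \<in> ?U. Q \<in># g \<and> dg Q = d_plus dg g}. f (dg Q))"
      by (simp add: Q_S_def)
  qed simp
  also have "\<dots> = (\<Sum>Q\<in>?U. \<Sum>g\<in>{g \<in> ?G. Q \<in># g \<and> dg Q = d_plus dg g}. f (dg Q))"
    by (rule sum.swap_restrict) (use fin in auto)
  also have "\<dots> / of_real q ^ n = (\<Sum>Q\<in>?U. fps_nth (gf (\<lambda>_. f (dg Q)) (add_mset Q ` free_on {P. dg P \<le> dg Q})) n)"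
    unfolding sum_divide_distrib[symmetric] gf_nth max_prime_set_eq[symmetric]
    by (simp add: conj_commute)
  also have "\<dots> = (\<Sum>Q\<in>?U. fps_nth (fps_const (f (dg Q)) * prime_fps Q * Nfps {P. dg P \<le> dg Q}) n)"
    unfolding Nfps_def by (intro sum.cong refl, subst gf_add_prime) auto
  finally show ?thesis by (simp add: max_gf_def gf_nth fps_sum_nth)
qed

lemma Nfps_le: "Nfps {P. dg P \<le> m} = Nfps UNIV * Mfps {P. dg P > m}"
proof -
  have "{P. dg P \<le> m} \<union> {P. dg P > m} = UNIV" "{P. dg P \<le> m} \<inter> {P. dg P > m} = {}" by auto
  then have "Nfps UNIV = Nfps {P. dg P \<le> m} * Nfps {P. dg P > m}" by (metis Nfps_Un)
  then have "Nfps UNIV * Mfps {P. dg P > m} = Nfps {P. dg P \<le> m} * (Nfps {P. dg P > m} * Mfps {P. dg P > m})"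
    by (simp only: mult.assoc)
  then show ?thesis by (simp add: Nfps_Mfps)
qed

text \<open>Alladi's duality: for each Q, the series of cofactors over primes of degree at most deg
  Q is Z times the Moebius series over primes of degree above deg Q.\<close>

lemma max_gf_eq: "max_gf S f = - (Nfps UNIV * Dgf S (\<lambda>g. of_int (mu_G g) * f (d_minus dg g)))"
proof (rule fps_ext)
  fix n
  let ?U = "{Q \<in> S. dg Q \<le> n}"
  let ?B = "\<Sum>Q\<in>?U. fps_const (f (dg Q)) * prime_fps Q * Mfps {P. dg P > dg Q}"
  have "fps_nth (max_gf S f) n = fps_nth (Nfps UNIV * ?B) n"
    unfolding max_gf_nth Nfps_le by (simp add: sum_distrib_left mult_ac)
  also have "\<dots> = fps_nth (- (Nfps UNIV * Dgf S (\<lambda>g. of_int (mu_G g) * f (d_minus dg g)))) n"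
    unfolding fps_neg_nth fps_mult_nth sum_negf[symmetric]
    by (rule sum.cong) (auto simp: Dgf_mu_nth[where K = n])
  finally show "fps_nth (max_gf S f) n = \<dots>" .
qed

end

section \<open>Equivalence of (i) and (ii)\<close>

context axiom_A_nonzero
begin

lemma Hfps_summable: "summable (\<lambda>n. norm (fps_nth Hfps n))"
  and Hfps_suminf: "suminf (fps_nth Hfps) = of_real c"
proof -
  have "norm (1::complex) < fps_conv_radius Hfps"
    by (rule in_Hfps_radius) (use one_less_inverse_\<rho> in simp)
  from norm_summable_fps[OF this] show "summable (\<lambda>n. norm (fps_nth Hfps n))" by simp
  show "suminf (fps_nth Hfps) = of_real c"
    using eval_Hfps_1 by (simp add: eval_fps_def)
qed

text \<open>The kernels \<open>Hfps\<close> and \<open>Tfps\<close> are summable with sums c and 1 /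
  c, so \<open>fps_mult_nth_tendsto\<close> transfers the limit in both directions.\<close>

lemma max_gf_tendsto_iff:
  "(fps_nth (max_gf S f) \<longlonglongrightarrow> of_real (c * \<delta>)) \<longleftrightarrow>
    (fps_nth (Dgf S (\<lambda>g. of_int (mu_G g) * f (d_minus dg g)) * ones_fps) \<longlonglongrightarrow> - of_real \<delta>)"
    (is "?L \<longleftrightarrow> ?R")
proof
  let ?B = "Dgf S (\<lambda>g. of_int (mu_G g) * f (d_minus dg g))"
  have max: "max_gf S f = - (Hfps * (?B * ones_fps))"
    by (simp add: max_gf_eq mult_ac flip: Hfps_ones)
  have B: "?B * ones_fps = - (Tfps * max_gf S f)"
  proof -
    have "Tfps * max_gf S f = - ((Nfps UNIV * Mfps UNIV) * (?B * ones_fps))"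
      by (simp add: max_gf_eq Tfps_def mult_ac)
    then show ?thesis by (simp add: Nfps_Mfps)
  qed
  show ?R if ?L
  proof -
    have "(\<lambda>n. - fps_nth (Tfps * max_gf S f) n) \<longlonglongrightarrow> - (suminf (fps_nth Tfps) * of_real (c * \<delta>))"
      by (intro tendsto_minus fps_mult_nth_tendsto Tfps_summable that)
    moreover have "fps_nth (?B * ones_fps) = (\<lambda>n. - fps_nth (Tfps * max_gf S f) n)"
      by (simp add: B fun_eq_iff)
    ultimately show ?thesis using c_pos by (simp add: Tfps_suminf)
  qed
  show ?L if ?R
  proof -
    have "(\<lambda>n. - fps_nth (Hfps * (?B * ones_fps)) n) \<longlonglongrightarrow> - (suminf (fps_nth Hfps) * (- of_real \<delta>))"
      by (intro tendsto_minus fps_mult_nth_tendsto Hfps_summable that)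
    moreover have "fps_nth (max_gf S f) = (\<lambda>n. - fps_nth (Hfps * (?B * ones_fps)) n)"
      by (simp add: max fun_eq_iff)
    ultimately show ?thesis by (simp add: Hfps_suminf)
  qed
qed

end

subsection \<open>Convolution with the Moebius function\<close>

lemma conv_mu_altdef: "conv_mu a g = (\<Sum>h\<in>{h. h \<subseteq># g}. of_int (mu_G (g - h)) * a h)"
proof -
  have "g - (g - h) = h" if "h \<subseteq># g" for h
    using that by (simp add: multiset_eq_iff subseteq_mset_def)
  then show ?thesis
    unfolding conv_mu_def
    by (intro sum.reindex_bij_witness[where i = "\<lambda>h. g - h" and j = "\<lambda>h. g - h"]) auto
qed

context graded_primes
begin

lemma deg_mono: "h \<subseteq># g \<Longrightarrow> deg h \<le> deg g"
  by (auto simp: mset_subset_eq_exists_conv)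

lemma prime_fps_mult_nth:
  "fps_nth (prime_fps Q * F) n = (if dg Q \<le> n then fps_nth F (n - dg Q) / of_real q ^ dg Q else 0)"
  by (simp add: prime_fps_def mult.assoc fps_X_power_mult_nth)

text \<open>For fixed h this collects the terms g = h + r of the double sum in (iii), with the
  factor a(h) / q^deg h taken out.\<close>

definition cofactor_gf :: "'p set \<Rightarrow> (nat \<Rightarrow> complex) \<Rightarrow> 'p multiset \<Rightarrow> complex fps" where
  "cofactor_gf S f h = gf (\<lambda>r. of_int (mu_G r) * f (d_minus dg (h + r))) {r. h + r \<in> Dset dg S}"

text \<open>If \<open>h + r\<close> is distinguishable with minimal prime \<open>Q\<close>, then either \<open>Q\<close> does not divide \<open>r\<close>, so that
  \<open>Q = Q\<^sub>0\<close>, or \<open>Q\<close> is also the minimal prime of \<open>r\<close>.\<close>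

lemma cofactor_gf_eq:
  assumes Q0: "Q\<^sub>0 \<in> S" "Q\<^sub>0 \<in># h" "\<And>P. P \<in># h \<Longrightarrow> P \<noteq> Q\<^sub>0 \<Longrightarrow> dg Q\<^sub>0 < dg P"
  shows "cofactor_gf S f h = fps_const (f (dg Q\<^sub>0)) * Mfps {P. dg P > dg Q\<^sub>0} -
    (\<Sum>Q\<in>insert Q\<^sub>0 {Q \<in> S. dg Q < dg Q\<^sub>0}. fps_const (f (dg Q)) * prime_fps Q * Mfps {P. dg P > dg Q})"
proof -
  let ?U = "insert Q\<^sub>0 {Q \<in> S. dg Q < dg Q\<^sub>0}"
  let ?w = "\<lambda>r. of_int (mu_G r) * f (d_minus dg (h + r))"
  let ?X = "free_on {P. dg P > dg Q\<^sub>0}" and ?Y = "\<Union>Q\<in>?U. with_min_prime Q"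
  have fin: "finite ?U"
    by (rule finite_subset[OF _ finite_dg_le[of "dg Q\<^sub>0"]]) auto
  have minX: "P \<noteq> Q\<^sub>0 \<Longrightarrow> dg Q\<^sub>0 < dg P" if "r \<in> ?X" "P \<in># h + r" for r P
    using that Q0(3) by (auto simp: free_on_def)
  \<comment> \<open>A prime Q of \<open>?U\<close> other than \<open>Q\<^sub>0\<close> has degree
    below every prime of h, so it stays the minimal prime after h is added.\<close>
  have minY: "P \<noteq> Q \<Longrightarrow> dg Q < dg P" if "Q \<in> ?U" "r \<in> with_min_prime Q" "P \<in># h + r" for r P Q
  proof -
    assume "P \<noteq> Q"
    from that(3) consider "P \<in># r" | "P \<in># h" by auto
    then show "dg Q < dg P"
    proof cases
      case 2
      then show ?thesis using Q0(3)[of P] that(1) \<open>P \<noteq> Q\<close> by (cases "P = Q\<^sub>0") auto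
    qed (use with_min_primeD[OF that(2)] \<open>P \<noteq> Q\<close> in auto)
  qed
  have "cofactor_gf S f h = gf ?w (?X \<union> ?Y)"
    unfolding cofactor_gf_def
  proof (rule gf_cong)
    fix r assume "r \<in> {r. h + r \<in> Dset dg S}"
    then obtain Q where Q: "Q \<in> S" "Q \<in># h + r" "\<forall>P\<in>#h + r. P \<noteq> Q \<longrightarrow> dg Q < dg P"
      using Q0(2) by (auto simp: Dset_iff)
    show "r \<in> ?X \<union> ?Y \<or> ?w r = 0"
    proof (rule disjCI)
      assume "?w r \<noteq> 0"
      then have mu: "mu_G r \<noteq> 0" by auto
      have h: "Q = Q\<^sub>0 \<or> dg Q < dg Q\<^sub>0" using Q(3) Q0(2) by auto
      show "r \<in> ?X \<union> ?Y"
      proof (cases "Q \<in># r")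
        case True
        then have "r \<in> with_min_prime Q"
          using Q(3) mu_G_nonzeroD[OF mu] by (intro with_min_primeI) auto
        then show ?thesis using h Q(1) by auto
      next
        case False
        then have "Q \<in># h" using Q(2) by auto
        then have "Q = Q\<^sub>0" using h Q0(3)[of Q] by (cases "Q = Q\<^sub>0") auto
        then have "r \<in> ?X" using Q(3) False by (auto simp: free_on_def)
        then show ?thesis by simp
      qed
    qed
  next
    fix r assume "r \<in> ?X \<union> ?Y"
    then have "h + r \<in> Dset dg S"
    proof
      assume "r \<in> ?X"
      then show ?thesis using minX[of r] Q0(1,2) by (auto simp: Dset_iff)
    next
      assume "r \<in> ?Y"
      then obtain Q where Q: "Q \<in> ?U" "r \<in> with_min_prime Q" by auto
      moreover have "Q \<in># r" using with_min_primeD(1)[OF Q(2)] .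
      ultimately show ?thesis using minY[OF Q] Q0(1) by (auto simp: Dset_iff)
    qed
    then show "r \<in> {r. h + r \<in> Dset dg S} \<or> ?w r = 0" by simp
  qed simp
  also have "\<dots> = gf ?w ?X + gf ?w ?Y"
  proof (rule gf_Un)
    have False if "r \<in> ?X" "r \<in> with_min_prime Q" "Q \<in> ?U" for r Q
      using that with_min_primeD(1)[OF that(2)] by (auto simp: free_on_def)
    then show "?X \<inter> ?Y = {}" by auto
  qed
  also have "gf ?w ?X = gf (\<lambda>r. f (dg Q\<^sub>0) * of_int (mu_G r)) ?X"
  proof (rule gf_cong)
    fix r assume "r \<in> ?X"
    then have "d_minus dg (h + r) = dg Q\<^sub>0"
      using Q0(2) minX[of r] by (intro d_minus_eqI) auto
    then show "?w r = f (dg Q\<^sub>0) * of_int (mu_G r)" by simp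
  qed auto
  also have "\<dots> = fps_const (f (dg Q\<^sub>0)) * Mfps {P. dg P > dg Q\<^sub>0}"
    unfolding Mfps_def by (rule gf_cmult)
  also have "gf ?w ?Y = - (\<Sum>Q\<in>?U. fps_const (f (dg Q)) * prime_fps Q * Mfps {P. dg P > dg Q})"
  proof (rule gf_UN_with_min_prime[OF fin])
    fix Q r assume Q: "Q \<in> ?U" and r: "r \<in> free_on {P. dg P > dg Q}"
    then have r': "add_mset Q r \<in> with_min_prime Q" by (auto simp: with_min_prime_def)
    have "d_minus dg (h + add_mset Q r) = dg Q"
      by (rule d_minus_eqI) (use minY[OF Q r'] in auto)
    then show "?w (add_mset Q r) = - f (dg Q) * of_int (mu_G r)"
      by (simp add: mu_G_add_min_prime[OF r])
  qed
  finally show ?thesis by simp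
qed

text \<open>The divisor h = e contributes exactly the sum in (ii) because a(e) = 1. For the others,
  the sums over g and h are exchanged and g = h + r is substituted.\<close>

lemma conv_mu_sum_eq:
  fixes a :: "'p multiset \<Rightarrow> complex"
  assumes supp: "\<And>g. g \<notin> Dset dg S \<Longrightarrow> a g = 0" and a0: "a {#} = 1"
  defines "G \<equiv> \<lambda>n. {g \<in> Dset dg S - {{#}}. deg g \<le> n}"
  shows "(\<Sum>g\<in>G n. conv_mu a g * f (d_minus dg g) / complex_of_real (q ^ deg g)) =
    (\<Sum>g\<in>G n. of_int (mu_G g) * f (d_minus dg g) / complex_of_real (q ^ deg g)) +
    (\<Sum>h\<in>G n. a h / of_real q ^ deg h * fps_nth (cofactor_gf S f h * ones_fps) (n - deg h))"
proof -
  have finG: "finite (G n)"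
    unfolding G_def by (rule finite_subset[OF _ finite_deg_le[of n]]) auto
  let ?F = "\<lambda>g. f (d_minus dg g) / complex_of_real (q ^ deg g)"
  have conv: "conv_mu a g = of_int (mu_G g) + (\<Sum>h\<in>{h \<in> G n. h \<subseteq># g}. of_int (mu_G (g - h)) * a h)"
    if g: "g \<in> G n" for g
  proof -
    have fin: "finite {h. h \<subseteq># g}"
      by (rule finite_subset[OF _ finite_deg_le[of "deg g"]]) (auto intro: deg_mono)
    have "conv_mu a g = of_int (mu_G g) + (\<Sum>h\<in>{h. h \<subseteq># g} - {{#}}. of_int (mu_G (g - h)) * a h)"
      unfolding conv_mu_altdef by (subst sum.remove[OF fin, of "{#}"]) (auto simp: a0)
    also have "(\<Sum>h\<in>{h. h \<subseteq># g} - {{#}}. of_int (mu_G (g - h)) * a h)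
        = (\<Sum>h\<in>{h \<in> G n. h \<subseteq># g}. of_int (mu_G (g - h)) * a h)"
    proof (rule sum.mono_neutral_right)
      show "\<forall>h\<in>{h. h \<subseteq># g} - {{#}} - {h \<in> G n. h \<subseteq># g}. of_int (mu_G (g - h)) * a h = 0"
      proof
        fix h assume h: "h \<in> {h. h \<subseteq># g} - {{#}} - {h \<in> G n. h \<subseteq># g}"
        then have "deg h \<le> n" using deg_mono[of h g] g by (auto simp: G_def)
        then show "of_int (mu_G (g - h)) * a h = 0" using h supp[of h] by (auto simp: G_def)
      qed
    qed (use fin in \<open>auto simp: G_def\<close>)
    finally show ?thesis .
  qed
  have "(\<Sum>g\<in>G n. conv_mu a g * f (d_minus dg g) / complex_of_real (q ^ deg g)) =
      (\<Sum>g\<in>G n. of_int (mu_G g) * f (d_minus dg g) / complex_of_real (q ^ deg g)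
        + (\<Sum>h\<in>{h \<in> G n. h \<subseteq># g}. of_int (mu_G (g - h)) * a h * ?F g))"
    by (intro sum.cong refl) (simp add: conv distrib_right add_divide_distrib sum_distrib_right sum_divide_distrib)
  also have "\<dots> = (\<Sum>g\<in>G n. of_int (mu_G g) * f (d_minus dg g) / complex_of_real (q ^ deg g))
      + (\<Sum>g\<in>G n. \<Sum>h\<in>{h \<in> G n. h \<subseteq># g}. of_int (mu_G (g - h)) * a h * ?F g)"
    by (rule sum.distrib)
  also have "(\<Sum>g\<in>G n. \<Sum>h\<in>{h \<in> G n. h \<subseteq># g}. of_int (mu_G (g - h)) * a h * ?F g)
      = (\<Sum>h\<in>G n. \<Sum>g\<in>{g \<in> G n. h \<subseteq># g}. of_int (mu_G (g - h)) * a h * ?F g)"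
    by (rule sum.swap_restrict[OF finG finG])
  also have "\<dots> = (\<Sum>h\<in>G n. a h / of_real q ^ deg h * fps_nth (cofactor_gf S f h * ones_fps) (n - deg h))"
  proof (rule sum.cong)
    fix h assume h: "h \<in> G n"
    \<comment> \<open>The cutoff deg g \<le> n becomes deg r \<le> n - deg h; as h is not the
      identity, neither is h + r.\<close>
    have "(\<Sum>g\<in>{g \<in> G n. h \<subseteq># g}. of_int (mu_G (g - h)) * a h * ?F g) =
        (\<Sum>r\<in>{r \<in> {r. h + r \<in> Dset dg S}. deg r \<le> n - deg h}. of_int (mu_G r) * a h * ?F (h + r))"
    proof (rule sum.reindex_bij_witness[where i = "\<lambda>r. h + r" and j = "\<lambda>g. g - h"])
      fix g assume g: "g \<in> {g \<in> G n. h \<subseteq># g}"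
      then show "h + (g - h) = g" by simp
      then have "deg g = deg h + deg (g - h)" by (metis degG_add)
      then show "g - h \<in> {r \<in> {r. h + r \<in> Dset dg S}. deg r \<le> n - deg h}"
        using g by (auto simp: G_def)
    next
      fix r assume "r \<in> {r \<in> {r. h + r \<in> Dset dg S}. deg r \<le> n - deg h}"
      then show "h + r \<in> {g \<in> G n. h \<subseteq># g}" using h by (auto simp: G_def)
    qed auto
    also have "\<dots> = a h / of_real q ^ deg h *
        (\<Sum>r\<in>{r \<in> {r. h + r \<in> Dset dg S}. deg r \<le> n - deg h}.
          of_int (mu_G r) * f (d_minus dg (h + r)) / complex_of_real (q ^ deg r))"
      unfolding sum_distrib_left by (intro sum.cong refl) (simp add: power_add)
    finally show "(\<Sum>g\<in>{g \<in> G n. h \<subseteq># g}. of_int (mu_G (g - h)) * a h * ?F g) =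
        a h / of_real q ^ deg h * fps_nth (cofactor_gf S f h * ones_fps) (n - deg h)"
      by (simp only: sum_deg_le_eq cofactor_gf_def)
  qed simp
  finally show ?thesis .
qed

end

section \<open>Vanishing of the difference between (iii) and (ii)\<close>

context axiom_A_nonzero
begin

lemma T_bound_nonneg: "T_bound \<ge> 0"
  using order.trans[OF norm_ge_zero norm_Mfps_gt_ones_le] .

text \<open>By \<open>cofactor_gf_eq\<close> this is a finite combination of Moebius partial sums
  over primes of large degree, each bounded and null. The coefficients add up to O(1 + S), where S
  is a sum of q^(-deg Q) that the Mertens bound makes logarithmic in deg h.\<close>

lemma cofactor_gf_ones:
  assumes "h \<in> Dset dg S - {{#}}" and f: "\<And>n. norm (f n) \<le> Fb"
  shows "fps_nth (cofactor_gf S f h * ones_fps) \<longlonglongrightarrow> 0"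
    and "norm (fps_nth (cofactor_gf S f h * ones_fps) n) \<le>
      Fb * T_bound * (1 + 2 * ln (2 * (c + C)) + 2 * ln (real (deg h)))"
proof -
  obtain Q\<^sub>0 where Q0: "Q\<^sub>0 \<in> S" "Q\<^sub>0 \<in># h" "\<And>P. P \<in># h \<Longrightarrow> P \<noteq> Q\<^sub>0 \<Longrightarrow> dg Q\<^sub>0 < dg P"
    using assms(1) by (auto simp: Dset_iff)
  let ?U = "insert Q\<^sub>0 {Q \<in> S. dg Q < dg Q\<^sub>0}"
  let ?E = "\<lambda>m. Mfps {P. dg P > m} * ones_fps"
  have Fb: "Fb \<ge> 0" using order.trans[OF norm_ge_zero f] .
  have "cofactor_gf S f h = fps_const (f (dg Q\<^sub>0)) * Mfps {P. dg P > dg Q\<^sub>0} -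
      (\<Sum>Q\<in>?U. fps_const (f (dg Q)) * prime_fps Q * Mfps {P. dg P > dg Q})"
    using Q0 by (rule cofactor_gf_eq)
  then have "cofactor_gf S f h * ones_fps = fps_const (f (dg Q\<^sub>0)) * ?E (dg Q\<^sub>0) -
      (\<Sum>Q\<in>?U. fps_const (f (dg Q)) * (prime_fps Q * ?E (dg Q)))"
    by (simp only: left_diff_distrib sum_distrib_right mult.assoc)
  then have eq: "fps_nth (cofactor_gf S f h * ones_fps) = (\<lambda>n. f (dg Q\<^sub>0) * fps_nth (?E (dg Q\<^sub>0)) n -
      (\<Sum>Q\<in>?U. f (dg Q) * fps_nth (prime_fps Q * ?E (dg Q)) n))"
    by (simp add: fun_eq_iff fps_sum_nth)
  have prime_lim: "fps_nth (prime_fps Q * ?E (dg Q)) \<longlonglongrightarrow> 0" for Q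
  proof (rule LIMSEQ_offset[where k = "dg Q"])
    have "(\<lambda>n. fps_nth (?E (dg Q)) n / of_real q ^ dg Q) \<longlonglongrightarrow> 0 / of_real q ^ dg Q"
      by (intro tendsto_intros Mfps_gt_ones_tendsto_0) simp
    then show "(\<lambda>n. fps_nth (prime_fps Q * ?E (dg Q)) (n + dg Q)) \<longlonglongrightarrow> 0"
      by (simp add: prime_fps_mult_nth)
  qed
  have "(\<lambda>n. f (dg Q\<^sub>0) * fps_nth (?E (dg Q\<^sub>0)) n -
      (\<Sum>Q\<in>?U. f (dg Q) * fps_nth (prime_fps Q * ?E (dg Q)) n)) \<longlonglongrightarrow>
      f (dg Q\<^sub>0) * 0 - (\<Sum>Q\<in>?U. f (dg Q) * 0)"
    by (intro tendsto_intros Mfps_gt_ones_tendsto_0 prime_lim)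
  then show "fps_nth (cofactor_gf S f h * ones_fps) \<longlonglongrightarrow> 0"
    unfolding eq by simp
  have prime_bound: "norm (fps_nth (prime_fps Q * ?E (dg Q)) n) \<le> T_bound * (1 / q ^ dg Q)" for Q n
  proof (cases "dg Q \<le> n")
    case True
    then show ?thesis
      using norm_Mfps_gt_ones_le[of "dg Q" "n - dg Q"] q_pos
      by (simp add: prime_fps_mult_nth norm_divide norm_power divide_right_mono)
  qed (use T_bound_nonneg q_pos in \<open>simp add: prime_fps_mult_nth\<close>)
  have d: "1 \<le> dg Q\<^sub>0" "dg Q\<^sub>0 \<le> deg h" using dg_pos[of Q\<^sub>0] dg_le_deg[OF Q0(2)] by auto
  have "norm (fps_nth (cofactor_gf S f h * ones_fps) n) \<le>
      Fb * T_bound + (\<Sum>Q\<in>?U. Fb * (T_bound * (1 / q ^ dg Q)))"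
    unfolding eq
    by (intro order.trans[OF norm_triangle_ineq4] add_mono order.trans[OF norm_sum] sum_mono)
      (auto simp: norm_mult simp del: mult_1_right times_divide_eq_right
        intro!: mult_mono f norm_Mfps_gt_ones_le prime_bound Fb)
  also have "\<dots> = Fb * T_bound * (1 + (\<Sum>Q\<in>?U. 1 / q ^ dg Q))"
    by (simp only: distrib_left mult_1_right sum_distrib_left mult.assoc)
  also have "(\<Sum>Q\<in>?U. 1 / q ^ dg Q) \<le> (\<Sum>Q\<in>{Q. dg Q \<le> dg Q\<^sub>0}. 1 / q ^ dg Q)"
    by (rule sum_mono2) (use finite_dg_le q_pos in auto)
  also have "\<dots> \<le> 2 * ln (2 * (c + C)) + 2 * ln (real (dg Q\<^sub>0))"
    using d by (intro Mertens_bound)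
  \<comment> \<open>Passing from deg \<open>Q\<^sub>0\<close> to deg h makes the bound depend on the
    degree of h alone.\<close>
  also have "\<dots> \<le> 2 * ln (2 * (c + C)) + 2 * ln (real (deg h))"
    using d by simp
  finally show "norm (fps_nth (cofactor_gf S f h * ones_fps) n) \<le>
      Fb * T_bound * (1 + 2 * ln (2 * (c + C)) + 2 * ln (real (deg h)))"
    using Fb T_bound_nonneg by (simp add: mult_left_mono add.assoc)
qed

text \<open>Compares the weights through log log q^m = log m + log log q. The last summand may be
  negative, so the comparison is made for large m only.\<close>

lemma summable_log_weight:
  fixes \<alpha> :: "nat \<Rightarrow> real"
  assumes nonneg: "\<And>m. \<alpha> m \<ge> 0" and sum: "summable (\<lambda>m. \<alpha> m * ln (ln (q ^ m)))" and B: "B \<ge> 0"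
  shows "summable (\<lambda>m. \<alpha> m * (A + B * ln (real m)))"
proof (rule summable_comparison_test_ev)
  let ?L = "ln (ln q)"
  show "summable (\<lambda>m. (\<bar>A\<bar> + B + 1) * (\<alpha> m * ln (ln (q ^ m))))"
    using sum by (rule summable_mult)
  have "filterlim (\<lambda>m. ln (real m)) at_top sequentially"
    by (rule filterlim_compose[OF ln_at_top filterlim_real_sequentially])
  \<comment> \<open>With K = |A| + B + 1 and L = log log q, this threshold gives log m + K L \<ge> K
    \<ge> |A|, which absorbs both constants.\<close>
  then have "\<forall>\<^sub>F m in sequentially. ln (real m) \<ge> (\<bar>A\<bar> + B + 1) * (\<bar>?L\<bar> + 1)"
    by (simp add: filterlim_at_top)
  moreover have "\<forall>\<^sub>F m in sequentially. m \<ge> 1" by (rule eventually_ge_at_top)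
  ultimately show "\<forall>\<^sub>F m in sequentially.
      norm (\<alpha> m * (A + B * ln (real m))) \<le> (\<bar>A\<bar> + B + 1) * (\<alpha> m * ln (ln (q ^ m)))"
  proof eventually_elim
    case (elim m)
    have "ln (q ^ m) = real m * ln q" using q_pos by (simp add: ln_realpow)
    then have ll: "ln (ln (q ^ m)) = ln (real m) + ?L"
      using elim(2) q_gt_1 by (simp add: ln_mult)
    let ?K = "\<bar>A\<bar> + B + 1"
    have K: "?K \<ge> 1" using B by simp
    have lm: "ln (real m) \<ge> 0" using elim(2) by simp
    have "\<bar>A + B * ln (real m)\<bar> \<le> \<bar>A\<bar> + B * ln (real m)"
      using B lm by (intro order.trans[OF abs_triangle_ineq]) simp
    also have "\<dots> \<le> ?K * (ln (real m) + ?L)"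
    proof -
      have "?K * (\<bar>?L\<bar> + 1) + ?K * ?L \<ge> ?K"
      proof -
        have "?K * (\<bar>?L\<bar> + 1) + ?K * ?L = ?K * (\<bar>?L\<bar> + ?L + 1)" by (simp add: algebra_simps)
        also have "\<dots> \<ge> ?K * 1" using K by (intro mult_left_mono) auto
        finally show ?thesis by simp
      qed
      then have "\<bar>A\<bar> \<le> ln (real m) + ?K * ?L" using elim(1) B by linarith
      moreover have "0 \<le> \<bar>A\<bar> * ln (real m)" using lm by simp
      ultimately show ?thesis by (simp add: algebra_simps)
    qed
    finally have "\<bar>A + B * ln (real m)\<bar> \<le> ?K * (ln (real m) + ?L)" .
    then have "\<alpha> m * \<bar>A + B * ln (real m)\<bar> \<le> \<alpha> m * (?K * (ln (real m) + ?L))"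
      using nonneg by (rule mult_left_mono)
    then show ?case using nonneg[of m] by (simp add: ll abs_mult mult_ac)
  qed
qed

text \<open>Tannery's theorem with the terms grouped by m = deg h: each group tends to 0 as n grows,
  and the log log hypothesis supplies a summable majorant.\<close>

lemma conv_mu_sum_diff_tendsto_0:
  fixes a :: "'p multiset \<Rightarrow> complex"
  assumes supp: "\<And>g. g \<notin> Dset dg S \<Longrightarrow> a g = 0" and a0: "a {#} = 1"
    and f: "\<And>n. norm (f n) \<le> Fb"
    and conv: "convergent (\<lambda>n. \<Sum>g\<in>{g. 1 \<le> deg g \<and> deg g \<le> n \<and> g \<in> Dset dg S}.
      norm (a g) / q ^ deg g * ln (ln (q ^ deg g)))"
  shows "(\<lambda>n. (\<Sum>g\<in>{g. 1 \<le> deg g \<and> deg g \<le> n \<and> g \<in> Dset dg S}.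
        conv_mu a g * f (d_minus dg g) / complex_of_real (q ^ deg g)) -
      (\<Sum>g\<in>{g. 1 \<le> deg g \<and> deg g \<le> n \<and> g \<in> Dset dg S}.
        of_int (mu_G g) * f (d_minus dg g) / complex_of_real (q ^ deg g))) \<longlonglongrightarrow> 0"
proof -
  let ?D = "\<lambda>m. {h \<in> Dset dg S - {{#}}. deg h = m}"
  define \<alpha> where "\<alpha> = (\<lambda>m. \<Sum>h\<in>?D m. norm (a h) / q ^ m)"
  define K where "K = (\<lambda>m. Fb * T_bound * (1 + 2 * ln (2 * (c + C)) + 2 * ln (real m)))"
  \<comment> \<open>The contribution of the h of degree m to the difference at cutoff n; it is 0 for
    m > n, where no such h occurs.\<close>
  define b where "b = (\<lambda>m n. if m \<le> n then \<Sum>h\<in>?D m. a h / of_real q ^ m *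
      fps_nth (cofactor_gf S f h * ones_fps) (n - m) else 0)"
  have Fb: "Fb \<ge> 0" using order.trans[OF norm_ge_zero f] .
  have group: "(\<Sum>h\<in>{h \<in> Dset dg S - {{#}}. deg h \<le> n}. F h) = (\<Sum>m\<le>n. \<Sum>h\<in>?D m. F h)"
    for F :: "'p multiset \<Rightarrow> 'b::comm_monoid_add" and n
  proof -
    have "(\<Sum>h\<in>{h \<in> Dset dg S - {{#}}. deg h \<le> n}. F h)
        = (\<Sum>m\<le>n. \<Sum>h\<in>{h \<in> {h \<in> Dset dg S - {{#}}. deg h \<le> n}. deg h = m}. F h)"
      by (rule sum.group[symmetric]) (auto intro: finite_subset[OF _ finite_deg_le[of n]])
    also have "\<dots> = (\<Sum>m\<le>n. \<Sum>h\<in>?D m. F h)"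
      by (intro sum.cong refl) auto
    finally show ?thesis .
  qed
  have "convergent (\<lambda>n. \<Sum>m\<le>n. \<alpha> m * ln (ln (q ^ m)))"
    using conv unfolding Dset_deg_between group \<alpha>_def by (simp add: sum_distrib_right)
  then have "summable (\<lambda>m. \<alpha> m * ln (ln (q ^ m)))"
    by (simp add: summable_iff_convergent')
  then have "summable (\<lambda>m. \<alpha> m * (Fb * T_bound * (1 + 2 * ln (2 * (c + C))) + (2 * Fb * T_bound) * ln (real m)))"
    using Fb T_bound_nonneg q_pos by (intro summable_log_weight) (auto simp: \<alpha>_def intro!: sum_nonneg)
  then have summ: "summable (\<lambda>m. \<alpha> m * K m)"
    by (simp add: K_def algebra_simps)
  have "(\<lambda>n. suminf (\<lambda>m. b m n)) \<longlonglongrightarrow> suminf (\<lambda>_::nat. 0)"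
  proof (rule conjunct2[OF conjunct2[OF tannerys_theorem[OF _ _ summ]]])
    fix m
    show "(\<lambda>n. b m n) \<longlonglongrightarrow> 0"
    proof (rule LIMSEQ_offset[where k = m])
      have "(\<lambda>n. \<Sum>h\<in>?D m. a h / of_real q ^ m * fps_nth (cofactor_gf S f h * ones_fps) n)
          \<longlonglongrightarrow> (\<Sum>h\<in>?D m. a h / of_real q ^ m * 0)"
        by (intro tendsto_intros cofactor_gf_ones(1)[OF _ f]) auto
      then show "(\<lambda>n. b m (n + m)) \<longlonglongrightarrow> 0" by (simp add: b_def)
    qed
    have "norm (b m n) \<le> \<alpha> m * K m" for m n
    proof -
      have bd: "norm (a h / of_real q ^ m * fps_nth (cofactor_gf S f h * ones_fps) k) \<le> norm (a h) / q ^ m * K m"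
        if "h \<in> ?D m" for h k
      proof -
        have "norm (fps_nth (cofactor_gf S f h * ones_fps) k) \<le> K m"
          using cofactor_gf_ones(2)[where h = h and S = S and f = f and n = k, OF _ f] that
          by (simp add: K_def)
        then have "norm (a h) / q ^ m * norm (fps_nth (cofactor_gf S f h * ones_fps) k) \<le> norm (a h) / q ^ m * K m"
          using q_pos by (intro mult_left_mono) auto
        then show ?thesis using q_pos by (simp add: norm_mult norm_divide norm_power)
      qed
      have "(\<Sum>h\<in>?D m. norm (a h) / q ^ m * K m) = \<alpha> m * K m"
        by (simp add: \<alpha>_def sum_distrib_right)
      moreover have "0 \<le> (\<Sum>h\<in>?D m. norm (a h) / q ^ m * K m)"
        by (intro sum_nonneg order.trans[OF norm_ge_zero bd])
      moreover have "norm (\<Sum>h\<in>?D m. a h / of_real q ^ m * fps_nth (cofactor_gf S f h * ones_fps) k)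
          \<le> (\<Sum>h\<in>?D m. norm (a h) / q ^ m * K m)" for k
        by (intro order.trans[OF norm_sum] sum_mono bd)
      ultimately show ?thesis
        by (cases "m \<le> n") (simp_all only: b_def if_True if_False norm_zero)
    qed
    then show "\<forall>\<^sub>F (m, n) in sequentially \<times>\<^sub>F sequentially. norm (b m n) \<le> \<alpha> m * K m"
      by (intro always_eventually) auto
  qed simp
  moreover have "suminf (\<lambda>m. b m n) = (\<Sum>g\<in>{g. 1 \<le> deg g \<and> deg g \<le> n \<and> g \<in> Dset dg S}.
        conv_mu a g * f (d_minus dg g) / complex_of_real (q ^ deg g)) -
      (\<Sum>g\<in>{g. 1 \<le> deg g \<and> deg g \<le> n \<and> g \<in> Dset dg S}.
        of_int (mu_G g) * f (d_minus dg g) / complex_of_real (q ^ deg g))" for n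
  proof -
    have "suminf (\<lambda>m. b m n) = (\<Sum>m\<le>n. b m n)"
      by (rule suminf_finite) (auto simp: b_def)
    also have "\<dots> = (\<Sum>h\<in>{h \<in> Dset dg S - {{#}}. deg h \<le> n}. a h / of_real q ^ deg h *
        fps_nth (cofactor_gf S f h * ones_fps) (n - deg h))"
      unfolding group by (intro sum.cong refl) (auto simp: b_def)
    also have "\<dots> = (\<Sum>g\<in>{g. 1 \<le> deg g \<and> deg g \<le> n \<and> g \<in> Dset dg S}.
        conv_mu a g * f (d_minus dg g) / complex_of_real (q ^ deg g)) -
      (\<Sum>g\<in>{g. 1 \<le> deg g \<and> deg g \<le> n \<and> g \<in> Dset dg S}.
        of_int (mu_G g) * f (d_minus dg g) / complex_of_real (q ^ deg g))"
      unfolding Dset_deg_between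
      using conv_mu_sum_eq[where S = S and a = a and f = f and n = n, OF supp a0] by simp
    finally show ?thesis .
  qed
  ultimately show ?thesis by simp
qed

end

section \<open>Transfer of the hypotheses to the normalised setting, and conclusion\<close>

theorem theorem2p3:
  fixes dg :: "'p \<Rightarrow> nat" and c q \<eta> \<delta> :: real and S :: "'p set"
    and f :: "nat \<Rightarrow> complex" and a :: "'p multiset \<Rightarrow> complex"
  assumes sg: "arith_semigroup dg"
    and A: "axiom_A_sharp dg c q \<eta>"
    and Z: "zeta_nonzero_at_minus dg q \<eta>"
    and dens: "natural_density dg S \<delta>"
    and f_bdd: "bounded (range f)"
    and f0: "f 0 = 0"
    and a_supp: "\<forall>g. g \<notin> Dset dg S \<longrightarrow> a g = 0"
    and a_e: "a {#} = 1"
    and a_conv: "convergent (\<lambda>n. \<Sum>g\<in>{g. 1 \<le> degG dg g \<and> degG dg g \<le> n \<and> g \<in> Dset dg S}.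
                   norm (a g) / q ^ degG dg g * ln (ln (q ^ degG dg g)))"
  shows "(((\<lambda>n. (\<Sum>g\<in>{g. degG dg g = n}. of_nat (Q_S dg S g) * f (d_plus dg g))
              - complex_of_real (c * \<delta> * q ^ n))
            \<in> o(\<lambda>n. complex_of_real (q ^ n)))
         \<longleftrightarrow>
         ((\<lambda>n. \<Sum>g\<in>{g. 1 \<le> degG dg g \<and> degG dg g \<le> n \<and> g \<in> Dset dg S}.
              of_int (mu_G g) * f (d_minus dg g) / complex_of_real (q ^ degG dg g))
            \<longlonglongrightarrow> - complex_of_real \<delta>)) \<and>
         (((\<lambda>n. \<Sum>g\<in>{g. 1 \<le> degG dg g \<and> degG dg g \<le> n \<and> g \<in> Dset dg S}.
              of_int (mu_G g) * f (d_minus dg g) / complex_of_real (q ^ degG dg g))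
            \<longlonglongrightarrow> - complex_of_real \<delta>)
         \<longleftrightarrow>
         ((\<lambda>n. \<Sum>g\<in>{g. 1 \<le> degG dg g \<and> degG dg g \<le> n \<and> g \<in> Dset dg S}.
              conv_mu a g * f (d_minus dg g) / complex_of_real (q ^ degG dg g))
            \<longlonglongrightarrow> - complex_of_real \<delta>))"
proof -
  have q: "q > 1" and c: "c > 0" and \<eta>: "0 \<le> \<eta>" "\<eta> < 1"
    and O: "(\<lambda>n. real (card {g::'p multiset. degG dg g = n}) - c * q ^ n) \<in> O(\<lambda>n. q powr (\<eta> * real n))"
    using A by (auto simp: axiom_A_sharp_def)
  interpret graded_primes dg q
    using sg q by unfold_locales (auto simp: arith_semigroup_def)
  \<comment> \<open>The error q^(\<eta> n) relative to q^n is \<rho>^n.\<close>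
  define \<rho> where "\<rho> = q powr (\<eta> - 1)"
  have \<rho>: "0 < \<rho>" "\<rho> < 1"
    using q \<eta> by (auto simp: \<rho>_def intro: powr_less_one)
  have \<rho>_pow: "q powr (\<eta> * real n) = \<rho> ^ n * q ^ n" for n
  proof -
    have "\<rho> ^ n * q ^ n = q powr ((\<eta> - 1) * real n) * q powr real n"
      using q \<rho> by (simp add: \<rho>_def powr_powr flip: powr_realpow)
    also have "\<dots> = q powr (\<eta> * real n)"
      by (simp add: algebra_simps flip: powr_add)
    finally show ?thesis ..
  qed
  have "\<exists>C. \<forall>n. norm (fps_nth (Nfps UNIV) n - complex_of_real c) \<le> C * \<rho> ^ n"
  proof -
    let ?x = "\<lambda>n. (real (card {g::'p multiset. degG dg g = n}) - c * q ^ n) / q powr (\<eta> * real n)"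
    from O obtain K where "\<forall>\<^sub>F n in sequentially.
        norm (real (card {g::'p multiset. degG dg g = n}) - c * q ^ n) \<le> K * norm (q powr (\<eta> * real n))"
      by (elim landau_o.bigE)
    then have "\<forall>\<^sub>F n in sequentially. norm (?x n) \<le> K"
      by eventually_elim (use q in \<open>simp add: norm_divide divide_le_eq\<close>)
    \<comment> \<open>Boundedness of the whole quotient sequence turns the eventual bound into one
      valid for all n.\<close>
    then have "Bseq ?x" by (rule BfunI)
    then obtain C where C: "\<forall>n. norm (?x n) \<le> C" unfolding Bseq_def by blast
    have "norm (fps_nth (Nfps UNIV) n - complex_of_real c) \<le> C * \<rho> ^ n" for n
    proof -
      have "fps_nth (Nfps UNIV) n - complex_of_real c = of_real (?x n * \<rho> ^ n)"
        using q \<rho> by (simp add: Nfps_nth_eq_card free_on_def \<rho>_pow field_simps)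
      then have "norm (fps_nth (Nfps UNIV) n - complex_of_real c) = norm (?x n) * \<rho> ^ n"
        using \<rho> by (simp only: norm_of_real abs_mult) simp
      also have "\<dots> \<le> C * \<rho> ^ n" using C \<rho> by (intro mult_right_mono) auto
      finally show ?thesis .
    qed
    then show ?thesis by blast
  qed
  then obtain C where C: "\<And>n. norm (fps_nth (Nfps UNIV) n - complex_of_real c) \<le> C * \<rho> ^ n" by blast
  interpret axiom_A dg q c C \<rho>
    using c \<rho> C by unfold_locales auto
  obtain F where F: "F holomorphic_on (ball (0::complex) (q powr (-\<eta>)) - {complex_of_real (1 / q)})"
    "\<forall>z\<in>ball 0 (1 / q). F z = zetaG dg z" "F (complex_of_real (-(1 / q))) \<noteq> 0"
    using Z by (auto simp: zeta_nonzero_at_minus_def)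
  \<comment> \<open>The map from z to z / q takes the disc of radius 1 / \<rho> to that of radius
    q^(-\<eta>) and the point 1 to the pole 1 / q.\<close>
  have scale: "norm z / q < q powr (-\<eta>) \<longleftrightarrow> norm z < 1 / \<rho>" for z :: complex
  proof -
    have "1 / \<rho> = q * q powr (-\<eta>)"
      using q by (simp add: \<rho>_def powr_diff powr_minus field_simps)
    then show ?thesis using q by (simp add: divide_less_eq mult.commute)
  qed
  interpret axiom_A_nonzero dg q c C \<rho>
  proof
    show "eval_fps Hfps (-1) \<noteq> 0"
    proof (rule Hfps_minus_one_nonzero)
      have "(F \<circ> (\<lambda>z. z / of_real q)) holomorphic_on ball 0 (1 / \<rho>) - {1}"
        by (rule holomorphic_on_compose_gen[OF _ F(1)])
          (use q scale in \<open>auto intro!: holomorphic_intros simp: norm_divide field_simps\<close>)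
      then show "(\<lambda>z. F (z / of_real q)) holomorphic_on ball 0 (1 / \<rho>) - {1}"
        by (simp add: o_def)
      show "F (z / of_real q) = eval_fps (Nfps UNIV) z" if "norm z < 1" for z
        using F(2) zetaG_eq_eval_Nfps[OF that] that q by (auto simp: norm_divide divide_strict_right_mono)
      show "F (- 1 / of_real q) \<noteq> 0" using F(3) by simp
    qed
  qed
  obtain Fb where Fb: "\<And>n. norm (f n) \<le> Fb"
    using f_bdd by (auto simp: bounded_iff)
  let ?B = "Dgf S (\<lambda>g. of_int (mu_G g) * f (d_minus dg g))"
  \<comment> \<open>After division by q^n, (i) says that the coefficients of \<open>max_gf\<close>
    tend to c \<delta>.\<close>
  have "((\<lambda>n. (\<Sum>g\<in>{g. degG dg g = n}. of_nat (Q_S dg S g) * f (d_plus dg g))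
              - complex_of_real (c * \<delta> * q ^ n)) \<in> o(\<lambda>n. complex_of_real (q ^ n)))
      \<longleftrightarrow> (\<lambda>n. fps_nth (max_gf S f) n - of_real (c * \<delta>)) \<longlonglongrightarrow> 0"
  proof -
    have "((\<Sum>g\<in>{g. degG dg g = n}. of_nat (Q_S dg S g) * f (d_plus dg g))
        - complex_of_real (c * \<delta> * q ^ n)) / complex_of_real (q ^ n)
        = fps_nth (max_gf S f) n - of_real (c * \<delta>)" for n
      using q by (simp add: max_gf_def gf_nth diff_divide_distrib)
    moreover have "\<forall>\<^sub>F n in sequentially. complex_of_real (q ^ n) \<noteq> 0"
      using q by simp
    ultimately show ?thesis
      using smalloI_tendsto[of "\<lambda>n. (\<Sum>g\<in>{g. degG dg g = n}. of_nat (Q_S dg S g) * f (d_plus dg g))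
          - complex_of_real (c * \<delta> * q ^ n)" "\<lambda>n. complex_of_real (q ^ n)" sequentially]
        smalloD_tendsto[of "\<lambda>n. (\<Sum>g\<in>{g. degG dg g = n}. of_nat (Q_S dg S g) * f (d_plus dg g))
          - complex_of_real (c * \<delta> * q ^ n)" sequentially "\<lambda>n. complex_of_real (q ^ n)"]
      by (simp only:) blast
  qed
  also have "\<dots> \<longleftrightarrow> fps_nth (max_gf S f) \<longlonglongrightarrow> of_real (c * \<delta>)"
    by (rule LIM_zero_iff)
  also have "\<dots> \<longleftrightarrow> fps_nth (?B * ones_fps) \<longlonglongrightarrow> - of_real \<delta>"
    by (rule max_gf_tendsto_iff)
  finally have i_ii: "((\<lambda>n. (\<Sum>g\<in>{g. degG dg g = n}. of_nat (Q_S dg S g) * f (d_plus dg g))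
              - complex_of_real (c * \<delta> * q ^ n)) \<in> o(\<lambda>n. complex_of_real (q ^ n)))
      \<longleftrightarrow> fps_nth (?B * ones_fps) \<longlonglongrightarrow> - of_real \<delta>" .
  let ?b = "\<lambda>n. \<Sum>g\<in>{g. 1 \<le> degG dg g \<and> degG dg g \<le> n \<and> g \<in> Dset dg S}.
      of_int (mu_G g) * f (d_minus dg g) / complex_of_real (q ^ degG dg g)"
  let ?c = "\<lambda>n. \<Sum>g\<in>{g. 1 \<le> degG dg g \<and> degG dg g \<le> n \<and> g \<in> Dset dg S}.
      conv_mu a g * f (d_minus dg g) / complex_of_real (q ^ degG dg g)"
  have "(\<lambda>n. ?c n - ?b n) \<longlonglongrightarrow> 0"
    by (rule conv_mu_sum_diff_tendsto_0[where Fb = Fb])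
      (use a_supp in blast, rule a_e, rule Fb, rule a_conv)
  then have ii_iii: "?b \<longlonglongrightarrow> - of_real \<delta> \<longleftrightarrow> ?c \<longlonglongrightarrow> - of_real \<delta>"
    by (rule Lim_transform_eq[symmetric])
  have "?b = fps_nth (?B * ones_fps)"
    by (simp only: Dgf_sum)
  then show ?thesis using i_ii ii_iii by simp
qed

end
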